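(* Suppose that $f_i'(u)+1\ne0$ and $f_i''(u)\ne0$ for all $u\in\mathbb R$ and all $1\le i\le k$. Then $\mathcal M_F$ is not $2$-curvature homogeneous.
   Context: Fix an integer $k\ge 1$ and signs $\varepsilon_1,\dots,\varepsilon_k\in\{\pm1\}$. Let $f_1,\dots,f_k:\mathbb R\to\mathbb R$ be smooth, $F=(f_1,\dots,f_k)$. On $\mathbb R^{3k+2}$ with coordinates $(u_0,\dots,u_k,v_0,\dots,v_k,s_1,\dots,s_k)$ let $g_F$ be the symmetric metric whose only nonzero components on coordinate vector fields are (up to symmetry), for $1\le i\le k$ and $0\le i',j\le k$: $g_F(\partial_{u_0},\partial_{u_i})=2f_i(u_i)s_i$, $g_F(\partial_{u_i},\partial_{u_i})=-2u_0s_i$, $g_F(\partial_{u_{i'}},\partial_{v_j})=\delta_{i'j}$, $g_F(\partial_{s_i},\partial_{s_i})=\varepsilon_i$; $\mathcal M_F=(\mathbb R^{3k+2},g_F)$. $\nabla$ is the Levi-Civita connection, $R(X,Y,Z,W)=g_F(\nabla_X\nabla_YZ-\nabla_Y\nabla_XZ-\nabla_{[X,Y]}Z,W)$, and $\nabla^\ell R(X_1,\dots,X_4;Y_1,\dots,Y_\ell)=(\nabla_{Y_\ell}\nabla^{\ell-1}R)(X_1,\dots,X_4;Y_1,\dots,Y_{\ell-1})$. A pseudo-Riemannian manifold $(M,g)$ is $\ell$-curvature homogeneous if for all $P,Q\in M$ there is a linear isometry $\Phi:T_PM\to T_QM$ with $\Phi^*(\nabla^iR)_Q=(\nabla^iR)_P$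 for $i=0,\dots,\ell$. *)

theory Defs
  imports "HOL-Analysis.Analysis"
begin

text \<open>Generic coordinate framework for a pseudo-Riemannian metric on R^N.
  Points and tangent vectors are functions nat => real vanishing at indices >= N;
  coordinate index a < N.  A metric is given by its components g x a b.\<close>

definition pts :: "nat \<Rightarrow> (nat \<Rightarrow> real) set" where
  "pts N = {x. \<forall>j\<ge>N. x j = 0}"

definition pd :: "((nat \<Rightarrow> real) \<Rightarrow> real) \<Rightarrow> nat \<Rightarrow> (nat \<Rightarrow> real) \<Rightarrow> real" where
  "pd h i x = deriv (\<lambda>t. h (x(i := t))) (x i)"

definition ginv :: "nat \<Rightarrow> ((nat \<Rightarrow> real) \<Rightarrow> nat \<Rightarrow> nat \<Rightarrow> real) \<Rightarrow> (nat \<Rightarrow> real) \<Rightarrow> nat \<Rightarrow> nat \<Rightarrow> real" where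
  "ginv N g x = (THE h. (\<forall>a<N. \<forall>b<N. (\<Sum>c<N. g x a c * h c b) = (if a = b then 1 else 0))
                     \<and> (\<forall>a b. \<not> (a < N \<and> b < N) \<longrightarrow> h a b = 0))"

text \<open>Christoffel symbols of the Levi-Civita connection:
  nabla_{d_a} d_b = sum_e Chr e a b d_e.\<close>
definition Chr :: "nat \<Rightarrow> ((nat \<Rightarrow> real) \<Rightarrow> nat \<Rightarrow> nat \<Rightarrow> real) \<Rightarrow> (nat \<Rightarrow> real) \<Rightarrow> nat \<Rightarrow> nat \<Rightarrow> nat \<Rightarrow> real" where
  "Chr N g x e a b = (1/2) * (\<Sum>d<N. ginv N g x e d *
      (pd (\<lambda>y. g y b d) a x + pd (\<lambda>y. g y a d) b x - pd (\<lambda>y. g y a b) d x))"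

text \<open>Components R(d_a,d_b,d_c,d_d) = g(nabla_a nabla_b d_c - nabla_b nabla_a d_c, d_d)
  (coordinate fields commute).  Tensors are component functions on index lists.\<close>
definition Rcomp :: "nat \<Rightarrow> ((nat \<Rightarrow> real) \<Rightarrow> nat \<Rightarrow> nat \<Rightarrow> real) \<Rightarrow> (nat \<Rightarrow> real) \<Rightarrow> nat list \<Rightarrow> real" where
  "Rcomp N g x idx = (case idx of
      [a, b, c, d] \<Rightarrow> (\<Sum>e<N. g x e d *
          (pd (\<lambda>y. Chr N g y e b c) a x - pd (\<lambda>y. Chr N g y e a c) b x
           + (\<Sum>f<N. Chr N g x f b c * Chr N g x e a f - Chr N g x f a c * Chr N g x e b f)))
    | _ \<Rightarrow> 0)"

text \<open>Covariant derivative of a covariant tensor; the new (differentiation) slot is the last one: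
  (nabla T)(X_1..X_r; Y) = (nabla_Y T)(X_1..X_r).\<close>
definition covD :: "nat \<Rightarrow> ((nat \<Rightarrow> real) \<Rightarrow> nat \<Rightarrow> nat \<Rightarrow> real)
     \<Rightarrow> ((nat \<Rightarrow> real) \<Rightarrow> nat list \<Rightarrow> real) \<Rightarrow> (nat \<Rightarrow> real) \<Rightarrow> nat list \<Rightarrow> real" where
  "covD N g T x idx = (let as = butlast idx; b = last idx in
      pd (\<lambda>y. T y as) b x
      - (\<Sum>j<length as. \<Sum>c<N. Chr N g x c b (as ! j) * T x (as[j := c])))"

fun nablaR :: "nat \<Rightarrow> ((nat \<Rightarrow> real) \<Rightarrow> nat \<Rightarrow> nat \<Rightarrow> real) \<Rightarrow> nat \<Rightarrow> (nat \<Rightarrow> real) \<Rightarrow> nat list \<Rightarrow> real" where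
  "nablaR N g 0 = Rcomp N g"
| "nablaR N g (Suc l) = covD N g (nablaR N g l)"

definition teval :: "nat \<Rightarrow> ((nat \<Rightarrow> real) \<Rightarrow> nat list \<Rightarrow> real) \<Rightarrow> (nat \<Rightarrow> real) \<Rightarrow> (nat \<Rightarrow> real) list \<Rightarrow> real" where
  "teval N T x vs = (\<Sum>idx\<in>{idx. length idx = length vs \<and> set idx \<subseteq> {..<N}}.
      T x idx * (\<Prod>j<length vs. (vs ! j) (idx ! j)))"

definition gval :: "nat \<Rightarrow> ((nat \<Rightarrow> real) \<Rightarrow> nat \<Rightarrow> nat \<Rightarrow> real) \<Rightarrow> (nat \<Rightarrow> real) \<Rightarrow> (nat \<Rightarrow> real) \<Rightarrow> (nat \<Rightarrow> real) \<Rightarrow> real" where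
  "gval N g x v w = (\<Sum>a<N. \<Sum>b<N. g x a b * v a * w b)"

definition matapp :: "nat \<Rightarrow> (nat \<Rightarrow> nat \<Rightarrow> real) \<Rightarrow> (nat \<Rightarrow> real) \<Rightarrow> nat \<Rightarrow> real" where
  "matapp N A v = (\<lambda>c. if c < N then (\<Sum>b<N. A c b * v b) else 0)"

definition curv_homog :: "nat \<Rightarrow> ((nat \<Rightarrow> real) \<Rightarrow> nat \<Rightarrow> nat \<Rightarrow> real) \<Rightarrow> nat \<Rightarrow> bool" where
  "curv_homog N g l \<longleftrightarrow>
     (\<forall>P\<in>pts N. \<forall>Q\<in>pts N. \<exists>A.
        bij_betw (matapp N A) (pts N) (pts N)
      \<and> (\<forall>v\<in>pts N. \<forall>w\<in>pts N. gval N g Q (matapp N A v) (matapp N A w) = gval N g P v w)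
      \<and> (\<forall>i\<le>l. \<forall>vs. length vs = 4 + i \<and> set vs \<subseteq> pts N \<longrightarrow>
            teval N (nablaR N g i) Q (map (matapp N A) vs) = teval N (nablaR N g i) P vs))"

definition smooth_fun :: "(real \<Rightarrow> real) \<Rightarrow> bool" where
  "smooth_fun f \<longleftrightarrow> (\<forall>n x. ((deriv ^^ n) f) differentiable (at x))"

text \<open>The metric g_F on R^(3k+2).  Coordinate indices: u_j = j (0<=j<=k),
  v_j = k+1+j (0<=j<=k), s_i = 2k+1+i (1<=i<=k).\<close>
definition gF :: "nat \<Rightarrow> (nat \<Rightarrow> real \<Rightarrow> real) \<Rightarrow> (nat \<Rightarrow> real) \<Rightarrow> (nat \<Rightarrow> real) \<Rightarrow> nat \<Rightarrow> nat \<Rightarrow> real" where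
  "gF k f eps x a b =
     (if \<exists>i\<in>{1..k}. (a = 0 \<and> b = i) \<or> (a = i \<and> b = 0)
        then (let i = a + b in 2 * f i (x i) * x (2*k+1+i))
      else if a = b \<and> a \<in> {1..k} then - 2 * x 0 * x (2*k+1+a)
      else if \<exists>j\<le>k. (a = j \<and> b = k+1+j) \<or> (a = k+1+j \<and> b = j) then 1
      else if a = b \<and> a \<in> {2*k+2..3*k+1} then eps (a - (2*k+1))
      else 0)"

end

theory Submission
  imports Defs
begin

text \<open>
  Put \<open>p\<^sub>i(x,y) = x\<^sub>0y\<^sub>i - x\<^sub>iy\<^sub>0\<close> and \<open>r\<^sub>i(x,y) = x\<^sub>i\<sigma>\<^sub>i(y) - \<sigma>\<^sub>i(x)y\<^sub>i\<close>, where \<open>x\<^sub>j\<close> and \<open>\<sigma>\<^sub>i(x)\<close> are the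
  components of \<open>x\<close> along \<open>\<partial>\<^sub>u\<^sub>j\<close> and \<open>\<partial>\<^sub>s\<^sub>i\<close>. Each of \<open>R\<close>, \<open>\<nabla>R\<close>, \<open>\<nabla>\<^sup>2R\<close> is a sum over the blocks \<open>i\<close> of
  \<open>A\<^sub>i (p\<^sub>i \<otimes> r\<^sub>i + r\<^sub>i \<otimes> p\<^sub>i) - B\<^sub>i p\<^sub>i \<otimes> p\<^sub>i\<close> times the i-th components of the differentiation slots, where \<open>A\<^sub>i\<close> is
  \<open>a = f' + 1\<close>, \<open>b = a'\<close>, \<open>c = b'\<close> respectively and each covariant derivative replaces \<open>B\<close> by
  \<open>B' + 2 \<epsilon> f A\<close>, starting from \<open>B = \<epsilon> f\<^sup>2\<close>.

  An isometry preserving these tensors permutes the blocks, and preserves \<open>ac/b\<^sup>2\<close> and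
  \<open>(B\<^sub>1a - B\<^sub>0b)b/a\<^sup>4\<close> of matching blocks, \<open>B\<^sub>0\<close> and \<open>B\<^sub>1\<close> being the coefficients in \<open>R\<close> and \<open>\<nabla>R\<close>. Under
  2-curvature homogeneity both functions of \<open>u\<^sub>1\<close> thus take finitely many values. By continuity
  \<open>ac/b\<^sup>2\<close> is constant, so \<open>a/b\<close>, whose derivative is \<open>1 - ac/b\<^sup>2\<close>, is affine; having no zero it is constant,
  and \<open>a\<close> is an exponential function. But then the second invariant is unbounded.
\<close>

section \<open>Coordinate vectors and partial derivatives\<close>

definition dirac :: "nat \<Rightarrow> nat \<Rightarrow> real" where
  "dirac a j = (if j = a then 1 else 0)"

lemma sum_dirac: "(\<Sum>c<N. w c * dirac c j) = (if j < N then w j else 0)"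
  by (simp add: dirac_def if_distrib cong: if_cong)

text \<open>\<open>deriv\<close> has a value even where no derivative exists, so \<open>pd\<close>
  alone obeys no sum or product rule. The relational form carries differentiability along.\<close>

definition has_pd :: "((nat \<Rightarrow> real) \<Rightarrow> real) \<Rightarrow> nat \<Rightarrow> (nat \<Rightarrow> real) \<Rightarrow> real \<Rightarrow> bool" where
  "has_pd h i x D \<longleftrightarrow> ((\<lambda>t. h (x(i := t))) has_real_derivative D) (at (x i))"

lemma has_pd_imp_pd: "has_pd h i x D \<Longrightarrow> pd h i x = D"
  unfolding has_pd_def pd_def by (rule DERIV_imp_deriv)

lemma has_pd_eq_rhs: "has_pd h i x D \<Longrightarrow> D = D' \<Longrightarrow> has_pd h i x D'"
  by simp

lemma has_pd_const: "has_pd (\<lambda>y. c) i x 0"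
  unfolding has_pd_def by simp

text \<open>Writing the case distinction \<open>i = j\<close> as a factor \<open>dirac i j\<close>
  keeps all derivatives polynomial in \<open>dirac\<close>, so that later identities reduce to ring
  normalisation.\<close>

lemma has_pd_compose:
  assumes "(g has_real_derivative D) (at (x j))"
  shows "has_pd (\<lambda>y. g (y j)) i x (D * dirac i j)"
  using assms unfolding has_pd_def dirac_def by (cases "i = j") auto

lemma has_pd_coord: "has_pd (\<lambda>y. y j) i x (dirac i j)"
  using has_pd_compose[of "\<lambda>t. t" 1 x j i] by simp

lemma has_pd_add:
  "has_pd h i x D \<Longrightarrow> has_pd h' i x D' \<Longrightarrow> has_pd (\<lambda>y. h y + h' y) i x (D + D')"
  unfolding has_pd_def by (rule DERIV_add)

lemma has_pd_diff:
  "has_pd h i x D \<Longrightarrow> has_pd h' i x D' \<Longrightarrow> has_pd (\<lambda>y. h y - h' y) i x (D - D')"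
  unfolding has_pd_def by (rule DERIV_diff)

lemma has_pd_mult:
  "has_pd h i x D \<Longrightarrow> has_pd h' i x D' \<Longrightarrow> has_pd (\<lambda>y. h y * h' y) i x (D * h' x + D' * h x)"
  unfolding has_pd_def by (drule (1) DERIV_mult) simp

lemma has_pd_sum:
  "(\<And>m. m \<in> A \<Longrightarrow> has_pd (\<lambda>y. h y m) i x (D m)) \<Longrightarrow>
    has_pd (\<lambda>y. \<Sum>m\<in>A. h y m) i x (\<Sum>m\<in>A. D m)"
  unfolding has_pd_def by (rule DERIV_sum)

lemmas has_pd_intros = has_pd_const has_pd_coord has_pd_add has_pd_diff has_pd_mult has_pd_sum

section \<open>Evaluation of component tensors on lists of vectors\<close>

lemma sum_lists_Suc:
  "(\<Sum>idx\<in>{idx. length idx = Suc n \<and> set idx \<subseteq> {..<N::nat}}. F idx)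
    = (\<Sum>a<N. \<Sum>idx\<in>{idx. length idx = n \<and> set idx \<subseteq> {..<N}}. F (a # idx))"
proof -
  let ?L = "\<lambda>n. {idx. length idx = n \<and> set idx \<subseteq> {..<N}}"
  have im: "?L (Suc n) = (\<lambda>(a, idx). a # idx) ` ({..<N} \<times> ?L n)"
    by (auto simp: length_Suc_conv image_iff)
  have inj: "inj_on (\<lambda>(a, idx). a # idx) ({..<N} \<times> ?L n)"
    by (auto simp: inj_on_def)
  show ?thesis
    unfolding im sum.reindex[OF inj] by (simp add: sum.cartesian_product case_prod_unfold comp_def)
qed

lemma teval_Nil: "teval N T x [] = T x []"
  by (simp add: teval_def) (subst sum.cong[of _ "{[]}" _ "T x"], auto)

lemma teval_Cons: "teval N T x (v # vs) = (\<Sum>a<N. v a * teval N (\<lambda>y idx. T y (a # idx)) x vs)"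
  unfolding teval_def
  by (simp add: sum_lists_Suc sum_distrib_left prod.lessThan_Suc_shift del: prod.lessThan_Suc)
     (simp add: mult_ac)

lemma teval_sum:
  "teval N (\<lambda>y idx. \<Sum>m\<in>A. T m y idx) x vs = (\<Sum>m\<in>A. teval N (T m) x vs)"
  unfolding teval_def by (subst sum.swap) (simp add: sum_distrib_right)

lemma teval_scale: "teval N (\<lambda>y idx. c * T y idx) x vs = c * teval N T x vs"
  unfolding teval_def by (simp add: sum_distrib_left mult_ac)

text \<open>The component function is that of a tensor power of the j-th coordinate covector, the
  shape in which the differentiation slots enter.\<close>

lemma teval_prod_dirac:
  assumes "j < N"
  shows "teval N (\<lambda>y idx. \<Prod>t\<leftarrow>map dirac idx. t j) x vs = (\<Prod>t\<leftarrow>vs. t j)"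
proof (induction vs)
  case Nil
  show ?case by (simp add: teval_Nil)
next
  case (Cons v vs)
  then show ?case
    using assms sum_dirac[where N = N and w = v and j = j]
    by (simp add: teval_Cons teval_scale mult.assoc[symmetric] sum_distrib_right[symmetric])
qed

section \<open>The metric and its inverse\<close>

locale F_metric =
  fixes k :: nat and f :: "nat \<Rightarrow> real \<Rightarrow> real" and eps :: "nat \<Rightarrow> real"
  assumes eps: "\<And>i. i \<in> {1..k} \<Longrightarrow> eps i = 1 \<or> eps i = -1"
    and smooth: "\<And>i. i \<in> {1..k} \<Longrightarrow> smooth_fun (f i)"
begin

abbreviation "g \<equiv> gF k f eps"
definition "N = 3*k+2"
definition "vx j = k+1+j"
definition "sx i = 2*k+1+i"

lemmas coord_defs = N_def vx_def sx_def

lemma coord_less [simp]: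
  "0 < N" "j \<le> k \<Longrightarrow> j < N" "j \<le> k \<Longrightarrow> vx j < N" "i \<in> {1..k} \<Longrightarrow> sx i < N"
  by (auto simp: coord_defs)

lemma eps_sq: "i \<in> {1..k} \<Longrightarrow> eps i * eps i = 1"
  using eps by fastforce

lemma DERIV_iter_deriv:
  assumes "i \<in> {1..k}"
  shows "((deriv ^^ n) (f i) has_real_derivative (deriv ^^ Suc n) (f i) u) (at u)"
  using smooth[OF assms] by (simp add: smooth_fun_def DERIV_deriv_iff_real_differentiable)

lemma DERIV_f:
  assumes "i \<in> {1..k}"
  shows "(f i has_real_derivative deriv (f i) u) (at u)"
    and "(deriv (f i) has_real_derivative deriv (deriv (f i)) u) (at u)"
    and "(deriv (deriv (f i)) has_real_derivative deriv (deriv (deriv (f i))) u) (at u)"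
  using DERIV_iter_deriv[OF assms, of 0] DERIV_iter_deriv[OF assms, of 1]
    DERIV_iter_deriv[OF assms, of 2] by (simp_all add: numeral_2_eq_2)

lemma sum_coords:
  fixes F :: "nat \<Rightarrow> real"
  shows "(\<Sum>c<N. F c) = (\<Sum>j\<le>k. F j) + (\<Sum>j\<le>k. F (vx j)) + (\<Sum>i=1..k. F (sx i))"
proof -
  have "{..<N} = {..k} \<union> ((\<lambda>j. vx j) ` {..k} \<union> (\<lambda>i. sx i) ` {1..k})"
  proof (intro equalityI subsetI)
    fix c assume "c \<in> {..<N}"
    then consider "c \<le> k" | "c = vx (c - (k+1))" "c - (k+1) \<le> k" | "c = sx (c - (2*k+1))" "c - (2*k+1) \<in> {1..k}"
      unfolding coord_defs by force
    then show "c \<in> {..k} \<union> ((\<lambda>j. vx j) ` {..k} \<union> (\<lambda>i. sx i) ` {1..k})"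
      by cases blast+
  qed (auto simp: coord_defs)
  moreover have "sum F ((\<lambda>j. vx j) ` {..k}) = (\<Sum>j\<le>k. F (vx j))"
    by (subst sum.reindex) (auto simp: inj_on_def coord_defs)
  moreover have "sum F ((\<lambda>i. sx i) ` {1..k}) = (\<Sum>i=1..k. F (sx i))"
    by (subst sum.reindex) (auto simp: inj_on_def coord_defs)
  moreover have "sum F ({..k} \<union> ((\<lambda>j. vx j) ` {..k} \<union> (\<lambda>i. sx i) ` {1..k}))
    = sum F {..k} + (sum F ((\<lambda>j. vx j) ` {..k}) + sum F ((\<lambda>i. sx i) ` {1..k}))"
    by (subst sum.union_disjoint, simp, simp, force simp: coord_defs)+ auto
  ultimately show ?thesis by simp
qed

text \<open>Replaces the nested conditionals of \<open>gF\<close> by a polynomial expression in the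
  components, which can be differentiated and also evaluated on arbitrary vectors.\<close>

definition gform :: "(nat \<Rightarrow> real) \<Rightarrow> (nat \<Rightarrow> real) \<Rightarrow> (nat \<Rightarrow> real) \<Rightarrow> real" where
  "gform x v w =
    (\<Sum>i=1..k. 2 * (f i (x i) * x (sx i)) * (v 0 * w i + v i * w 0)
       - 2 * (x 0 * x (sx i)) * (v i * w i) + eps i * (v (sx i) * w (sx i)))
    + (\<Sum>j\<le>k. v j * w (vx j) + v (vx j) * w j)"

lemma sum_dirac_u: "(\<Sum>i=1..k. F i * dirac a i) = (if a \<in> {1..k} then F a else 0)"
  by (simp add: dirac_def if_distrib cong: if_cong)

lemma sum_dirac_u0: "(\<Sum>j\<le>k. F j * dirac a j) = (if a \<le> k then F a else 0)"
  by (simp add: dirac_def if_distrib cong: if_cong)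

lemma sum_dirac_s:
  "(\<Sum>i=1..k. F i * dirac a (sx i)) = (if a \<in> {2*k+2..3*k+1} then F (a - (2*k+1)) else 0)"
proof -
  have "(\<Sum>i=1..k. F i * dirac a (sx i))
      = (\<Sum>i=1..k. if i = a - (2*k+1) then (if a \<in> {2*k+2..3*k+1} then F i else 0) else 0)"
    by (intro sum.cong) (auto simp: dirac_def coord_defs)
  then show ?thesis by auto
qed

lemma sum_dirac_v:
  "(\<Sum>j\<le>k. F j * dirac a (vx j)) = (if a \<in> {k+1..2*k+1} then F (a - (k+1)) else 0)"
proof -
  have "(\<Sum>j\<le>k. F j * dirac a (vx j))
      = (\<Sum>j\<le>k. if j = a - (k+1) then (if a \<in> {k+1..2*k+1} then F j else 0) else 0)"
    by (intro sum.cong) (auto simp: dirac_def coord_defs)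
  then show ?thesis by auto
qed

lemma gF_eq_gform: "g x a b = gform x (dirac a) (dirac b)"
proof -
  have "gform x (dirac a) (dirac b) =
      (\<Sum>i=1..k. (2 * (f i (x i) * x (sx i)) * dirac a 0) * dirac b i)
    + (\<Sum>i=1..k. (2 * (f i (x i) * x (sx i)) * dirac b 0) * dirac a i)
    - (\<Sum>i=1..k. (2 * (x 0 * x (sx i)) * dirac a i) * dirac b i)
    + (\<Sum>i=1..k. (eps i * dirac a (sx i)) * dirac b (sx i))
    + (\<Sum>j\<le>k. dirac a j * dirac b (vx j)) + (\<Sum>j\<le>k. dirac b j * dirac a (vx j))"
    unfolding gform_def by (simp add: sum.distrib sum_subtractf algebra_simps)
  also have "\<dots> = g x a b"
    unfolding sum_dirac_u sum_dirac_s sum_dirac_v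
    by (auto simp: dirac_def gF_def coord_defs)
  finally show ?thesis ..
qed

lemma gform_sym: "gform x v w = gform x w v"
  by (simp add: gform_def algebra_simps)

lemma gF_v: "j \<le> k \<Longrightarrow> g x a (vx j) = dirac a j"
  by (auto simp: gF_def dirac_def coord_defs)

lemma gF_s: "i \<in> {1..k} \<Longrightarrow> g x a (sx i) = eps i * dirac a (sx i)"
  by (auto simp: gF_def dirac_def coord_defs)

text \<open>In the order u, v, s the metric has block rows (G, 1, 0), (1, 0, 0), (0, 0, E) with E
  diagonal and of square 1. Its inverse has block rows (0, 1, 0), (1, -G, 0), (0, 0, E).\<close>

definition gF_inv :: "(nat \<Rightarrow> real) \<Rightarrow> nat \<Rightarrow> nat \<Rightarrow> real" where
  "gF_inv x a b =
    (if a \<le> k then dirac b (vx a)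
     else if a \<le> 2*k+1 then
       (if b \<le> k then dirac a (vx b) else if b \<le> 2*k+1 then - g x (a-(k+1)) (b-(k+1)) else 0)
     else if a < N then eps (a-(2*k+1)) * dirac a b else 0)"

lemma gF_inv_sym: "gF_inv x a b = gF_inv x b a"
  by (auto simp: gF_inv_def dirac_def gF_eq_gform coord_defs intro: gform_sym)

lemma gF_sym: "g x a b = g x b a"
  unfolding gF_eq_gform by (rule gform_sym)

lemma gF_inv_right:
  assumes "a < N" "b < N"
  shows "(\<Sum>c<N. g x a c * gF_inv x c b) = dirac a b"
proof -
  have "(\<Sum>c<N. g x a c * gF_inv x c b) =
     (\<Sum>j\<le>k. g x a j * dirac b (vx j)) + (\<Sum>j\<le>k. gF_inv x (vx j) b * dirac a j)
     + (\<Sum>i=1..k. (eps i * gF_inv x (sx i) b) * dirac a (sx i))"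
    unfolding sum_coords
  proof (intro arg_cong2[where f = "(+)"] sum.cong refl)
    fix j assume "j \<in> {..k}"
    then show "g x a j * gF_inv x j b = g x a j * dirac b (vx j)"
      by (simp add: gF_inv_def)
  next
    fix j assume "j \<in> {..k}"
    then show "g x a (vx j) * gF_inv x (vx j) b = gF_inv x (vx j) b * dirac a j"
      by (simp add: gF_v)
  next
    fix i assume "i \<in> {1..k}"
    then show "g x a (sx i) * gF_inv x (sx i) b = eps i * gF_inv x (sx i) b * dirac a (sx i)"
      by (simp add: gF_s)
  qed
  also have "\<dots> = dirac a b"
  proof -
    consider "b \<le> k" | l where "l \<le> k" "b = vx l" | i where "i \<in> {1..k}" "b = sx i"
    proof -
      have "b \<le> k \<or> b - (k+1) \<le> k \<and> b = vx (b - (k+1))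
          \<or> b - (2*k+1) \<in> {1..k} \<and> b = sx (b - (2*k+1))"
        using assms(2) by (auto simp: coord_defs)
      then show ?thesis using that by blast
    qed
    then show ?thesis
    proof cases
      case 1
      then have "gF_inv x (vx j) b = dirac b j" if "j \<le> k" for j
        using that by (auto simp: gF_inv_def dirac_def coord_defs)
      moreover have "gF_inv x (sx i) b = 0" if "i \<in> {1..k}" for i
        using 1 that by (auto simp: gF_inv_def dirac_def coord_defs)
      moreover have "dirac b (vx j) = 0" for j
        using 1 by (auto simp: dirac_def coord_defs)
      ultimately show ?thesis
        using 1 by (simp add: sum_dirac_u0) (auto simp: dirac_def)
    next
      case 2
      have "gF_inv x (vx j) b = - g x j l" if "j \<le> k" for j
        using that 2 by (simp add: gF_inv_def vx_def)
      moreover have "gF_inv x (sx i) b = 0" if "i \<in> {1..k}" for i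
        using 2 that by (auto simp: gF_inv_def dirac_def coord_defs)
      moreover have "g x a l = dirac a b" if "\<not> a \<le> k"
        using that 2 assms(1) unfolding gF_sym[of x a]
        by (auto simp: gF_def dirac_def coord_defs)
      moreover have "dirac b (vx j) = dirac l j" for j
        by (simp add: 2 dirac_def vx_def)
      ultimately show ?thesis
        using 2 by (simp add: sum_dirac_u0 sum_negf) (auto simp: dirac_def vx_def)
    next
      case 3
      have "gF_inv x (vx j) b = 0" "dirac b (vx j) = 0" if "j \<le> k" for j
        using that 3 by (auto simp: gF_inv_def dirac_def coord_defs)
      moreover have "eps m * gF_inv x (sx m) b = dirac i m" if "m \<in> {1..k}" for m
        using that 3 eps_sq[OF that] by (auto simp: gF_inv_def dirac_def coord_defs)
      ultimately show ?thesis
        using 3 sum_dirac_u[of "\<lambda>m. dirac a (sx m)" i]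
        by (simp add: mult.commute)
    qed
  qed
  finally show ?thesis .
qed

lemma ginv_eq: "ginv N g x = gF_inv x"
proof -
  have right: "(\<Sum>c<N. g x a c * gF_inv x c b) = (if a = b then 1 else 0)"
    if "a < N" "b < N" for a b
    using gF_inv_right[OF that] by (simp add: dirac_def)
  \<comment> \<open>Both matrices are symmetric, so transposing the right inverse identity gives the
    left one, which the uniqueness argument needs.\<close>
  have left: "(\<Sum>c<N. gF_inv x a c * g x c b) = (if a = b then 1 else 0)"
    if "a < N" "b < N" for a b
  proof -
    have "(\<Sum>c<N. gF_inv x a c * g x c b) = (\<Sum>c<N. g x b c * gF_inv x c a)"
      by (intro sum.cong refl) (metis mult.commute gF_sym gF_inv_sym)
    then show ?thesis using right[OF that(2,1)] by auto
  qed
  show ?thesis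
    unfolding ginv_def
  proof (intro the_equality conjI allI impI)
    fix a b assume "a < N" "b < N"
    then show "(\<Sum>c<N. g x a c * gF_inv x c b) = (if a = b then 1 else 0)"
      by (rule right)
  next
    fix a b assume "\<not> (a < N \<and> b < N)"
    then show "gF_inv x a b = 0"
      by (auto simp: gF_inv_def dirac_def coord_defs)
  next
    fix h assume *: "(\<forall>a<N. \<forall>b<N. (\<Sum>c<N. g x a c * h c b) = (if a = b then 1 else 0))
      \<and> (\<forall>a b. \<not> (a < N \<and> b < N) \<longrightarrow> h a b = 0)"
    note h = conjunct1[OF *] and h0 = conjunct2[OF *]
    show "h = gF_inv x"
    proof (intro ext)
      fix a b
      show "h a b = gF_inv x a b"
      proof (cases "a < N \<and> b < N")
        case True
        \<comment> \<open>Associativity: a right inverse \<open>h\<close> equals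
          (\<open>gF_inv\<close> g) h = \<open>gF_inv\<close> (g h) = \<open>gF_inv\<close>.\<close>
        have "h a b = (\<Sum>d<N. (\<Sum>c<N. gF_inv x a c * g x c d) * h d b)"
        proof -
          have "(\<Sum>d<N. (\<Sum>c<N. gF_inv x a c * g x c d) * h d b)
              = (\<Sum>d<N. if d = a then h d b else 0)"
            using True by (intro sum.cong) (auto simp: left)
          then show ?thesis using True by simp
        qed
        also have "\<dots> = (\<Sum>c<N. gF_inv x a c * (\<Sum>d<N. g x c d * h d b))"
          unfolding sum_distrib_left sum_distrib_right by (subst sum.swap) (simp add: mult_ac)
        also have "\<dots> = gF_inv x a b"
        proof -
          have "(\<Sum>c<N. gF_inv x a c * (\<Sum>d<N. g x c d * h d b))
              = (\<Sum>c<N. if c = b then gF_inv x a c else 0)"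
            using True h by (intro sum.cong) auto
          then show ?thesis using True by simp
        qed
        finally show ?thesis .
      next
        case False
        then show ?thesis using h0 by (auto simp: gF_inv_def dirac_def coord_defs)
      qed
    qed
  qed
qed

section \<open>The Levi-Civita connection\<close>

definition Chr_s :: "(nat \<Rightarrow> real) \<Rightarrow> nat \<Rightarrow> (nat \<Rightarrow> real) \<Rightarrow> (nat \<Rightarrow> real) \<Rightarrow> real" where
  "Chr_s x i v w = eps i * (x 0 * (v i * w i) - f i (x i) * (v 0 * w i + v i * w 0))"

lemma has_pd_gF:
  "has_pd (\<lambda>y. g y b d) a x
    (\<Sum>i=1..k. 2 * (deriv (f i) (x i) * dirac a i * x (sx i) + f i (x i) * dirac a (sx i))
         * (dirac b 0 * dirac d i + dirac b i * dirac d 0)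
       - 2 * (dirac a 0 * x (sx i) + x 0 * dirac a (sx i)) * (dirac b i * dirac d i))"
  unfolding gF_eq_gform gform_def
  by (rule has_pd_eq_rhs, (rule has_pd_intros has_pd_compose DERIV_f | assumption)+)
     (simp add: algebra_simps)

text \<open>The metric components vary only with u and s, and those with a v-index are constant, so
  symbols of the first kind carry no v-index. Raising turns a lower u_j into an upper v_j and
  multiplies s_i by its sign; hence no upper u-index occurs.\<close>

lemma Chr_eq:
  "Chr N g x e a b = (\<Sum>i=1..k. dirac e (sx i) * Chr_s x i (dirac a) (dirac b)
     + dirac e (vx 0) * ((2 * deriv (f i) (x i) + 1) * x (sx i) * (dirac a i * dirac b i)
         + f i (x i) * (dirac a i * dirac b (sx i) + dirac a (sx i) * dirac b i))
     + dirac e (vx i) * (f i (x i) * (dirac a 0 * dirac b (sx i) + dirac a (sx i) * dirac b 0)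
         - x (sx i) * (dirac a 0 * dirac b i + dirac a i * dirac b 0)
         - x 0 * (dirac a i * dirac b (sx i) + dirac a (sx i) * dirac b i)))"
proof -
  \<comment> \<open>\<open>\<Gamma>0\<close>, \<open>\<Gamma>u\<close> and \<open>\<Gamma>s\<close>
    collect the symbols of the first kind with third index u_0, u_i and s_i.\<close>
  define \<Gamma>0 where "\<Gamma>0 i = (2 * deriv (f i) (x i) + 1) * x (sx i) * (dirac a i * dirac b i)
         + f i (x i) * (dirac a i * dirac b (sx i) + dirac a (sx i) * dirac b i)" for i
  define \<Gamma>u where "\<Gamma>u i = f i (x i) * (dirac a 0 * dirac b (sx i) + dirac a (sx i) * dirac b 0)
         - x (sx i) * (dirac a 0 * dirac b i + dirac a i * dirac b 0)
         - x 0 * (dirac a i * dirac b (sx i) + dirac a (sx i) * dirac b i)" for i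
  define \<Gamma>s where "\<Gamma>s i = x 0 * (dirac a i * dirac b i)
         - f i (x i) * (dirac a 0 * dirac b i + dirac a i * dirac b 0)" for i
  have first_kind: "pd (\<lambda>y. g y b d) a x + pd (\<lambda>y. g y a d) b x - pd (\<lambda>y. g y a b) d x
      = 2 * (\<Sum>i=1..k. \<Gamma>0 i * dirac d 0 + \<Gamma>u i * dirac d i + \<Gamma>s i * dirac d (sx i))" for d
    unfolding has_pd_gF[THEN has_pd_imp_pd] \<Gamma>0_def \<Gamma>u_def \<Gamma>s_def
    unfolding sum_distrib_left sum.distrib[symmetric] sum_subtractf[symmetric]
    by (intro sum.cong) (simp_all add: algebra_simps)
  have "Chr N g x e a b = (\<Sum>d<N. \<Sum>i=1..k. \<Gamma>0 i * (gF_inv x e d * dirac d 0)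
      + \<Gamma>u i * (gF_inv x e d * dirac d i) + \<Gamma>s i * (gF_inv x e d * dirac d (sx i)))"
    unfolding Chr_def ginv_eq first_kind sum_distrib_left
    by (intro sum.cong) (simp_all add: algebra_simps)
  also have "\<dots> = (\<Sum>i=1..k. \<Gamma>0 i * gF_inv x e 0 + \<Gamma>u i * gF_inv x e i + \<Gamma>s i * gF_inv x e (sx i))"
    apply (subst sum.swap)
    unfolding sum.distrib sum_distrib_left[symmetric] sum_dirac
    unfolding sum.distrib[symmetric] by (intro sum.cong) auto
  also have "\<dots> = (\<Sum>i=1..k. dirac e (sx i) * Chr_s x i (dirac a) (dirac b)
     + dirac e (vx 0) * \<Gamma>0 i + dirac e (vx i) * \<Gamma>u i)"
  proof (intro sum.cong refl)
    fix i assume i: "i \<in> {1..k}"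
    have "gF_inv x e 0 = dirac e (vx 0)" "gF_inv x e i = dirac e (vx i)"
      "gF_inv x e (sx i) = eps i * dirac e (sx i)"
      using i by (auto simp: gF_inv_def dirac_def coord_defs)
    then show "\<Gamma>0 i * gF_inv x e 0 + \<Gamma>u i * gF_inv x e i + \<Gamma>s i * gF_inv x e (sx i)
      = dirac e (sx i) * Chr_s x i (dirac a) (dirac b) + dirac e (vx 0) * \<Gamma>0 i + dirac e (vx i) * \<Gamma>u i"
      by (simp add: Chr_s_def \<Gamma>s_def)
  qed
  finally show ?thesis unfolding \<Gamma>0_def \<Gamma>u_def .
qed

lemma Chr_u: "j \<le> k \<Longrightarrow> Chr N g x j a b = 0"
  unfolding Chr_eq by (intro sum.neutral) (auto simp: dirac_def coord_defs)

lemma Chr_s: 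
  assumes "j \<in> {1..k}"
  shows "Chr N g x (sx j) a b = Chr_s x j (dirac a) (dirac b)"
proof -
  have "Chr N g x (sx j) a b = (\<Sum>i=1..k. Chr_s x i (dirac a) (dirac b) * dirac j i)"
    unfolding Chr_eq using assms by (intro sum.cong) (auto simp: dirac_def coord_defs)
  then show ?thesis using assms by (simp only: sum_dirac_u) simp
qed

text \<open>The curvature tensors only see the u- and s-coordinates, and the Christoffel symbols have no
  upper u-index; hence contracting with them only involves the s-components.\<close>

lemma Chr_contract:
  "(\<Sum>c<N. Chr N g x c a b * (\<Sum>i=1..k. dirac c 0 * X i + dirac c i * Y i + dirac c (sx i) * Z i))
    = (\<Sum>i=1..k. Chr_s x i (dirac a) (dirac b) * Z i)"
proof -
  have "(\<Sum>c<N. Chr N g x c a b * (\<Sum>i=1..k. dirac c 0 * X i + dirac c i * Y i + dirac c (sx i) * Z i))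
    = (\<Sum>i=1..k. \<Sum>c<N. X i * (Chr N g x c a b * dirac c 0) + Y i * (Chr N g x c a b * dirac c i)
        + Z i * (Chr N g x c a b * dirac c (sx i)))"
    unfolding sum_distrib_left by (subst sum.swap) (intro sum.cong, simp_all add: algebra_simps)
  also have "\<dots> = (\<Sum>i=1..k. Chr_s x i (dirac a) (dirac b) * Z i)"
    unfolding sum.distrib sum_distrib_left[symmetric] sum_dirac
    unfolding sum.distrib[symmetric]
    by (intro sum.cong) (auto simp: Chr_u Chr_s)
  finally show ?thesis .
qed

section \<open>The curvature tensor and its covariant derivatives\<close>

definition pf :: "nat \<Rightarrow> (nat \<Rightarrow> real) \<Rightarrow> (nat \<Rightarrow> real) \<Rightarrow> real" where
  "pf i v w = v 0 * w i - v i * w 0"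

definition rf :: "nat \<Rightarrow> (nat \<Rightarrow> real) \<Rightarrow> (nat \<Rightarrow> real) \<Rightarrow> real" where
  "rf i v w = v i * w (sx i) - v (sx i) * w i"

text \<open>Arguments are vectors rather than indices: on \<open>dirac\<close> lists this gives the
  tensor components, on other lists the multilinear evaluation.\<close>

definition curv_form ::
  "(nat \<Rightarrow> real \<Rightarrow> real) \<Rightarrow> (nat \<Rightarrow> real \<Rightarrow> real) \<Rightarrow> (nat \<Rightarrow> real) \<Rightarrow> (nat \<Rightarrow> real) list \<Rightarrow> real" where
  "curv_form A B x vs = (case vs of
      a # b # c # d # ts \<Rightarrow>
        (\<Sum>i=1..k. (A i (x i) * (pf i a b * rf i c d + rf i a b * pf i c d)
            - B i (x i) * (pf i a b * pf i c d)) * (\<Prod>t\<leftarrow>ts. t i))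
    | _ \<Rightarrow> 0)"

lemma curv_form_Cons:
  "curv_form A B x (a # b # c # d # ts) =
    (\<Sum>i=1..k. (A i (x i) * (pf i a b * rf i c d + rf i a b * pf i c d)
            - B i (x i) * (pf i a b * pf i c d)) * (\<Prod>t\<leftarrow>ts. t i))"
  by (simp add: curv_form_def)

text \<open>Lowering an index undoes the raising in \<open>Chr_eq\<close>: an upper v_j becomes a
  lower u_j, and s_i acquires its sign.\<close>

lemma gF_contract:
  "(\<Sum>e<N. g x e d * (\<Sum>i=1..k. dirac e (sx i) * X i + dirac e (vx 0) * Y i + dirac e (vx i) * Z i))
    = (\<Sum>i=1..k. eps i * dirac d (sx i) * X i + dirac d 0 * Y i + dirac d i * Z i)"
proof -
  have "(\<Sum>e<N. g x e d * (\<Sum>i=1..k. dirac e (sx i) * X i + dirac e (vx 0) * Y i + dirac e (vx i) * Z i))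
    = (\<Sum>i=1..k. \<Sum>e<N. X i * (g x e d * dirac e (sx i)) + Y i * (g x e d * dirac e (vx 0))
        + Z i * (g x e d * dirac e (vx i)))"
    unfolding sum_distrib_left by (subst sum.swap) (intro sum.cong, simp_all add: algebra_simps)
  also have "\<dots> = (\<Sum>i=1..k. X i * g x (sx i) d + Y i * g x (vx 0) d + Z i * g x (vx i) d)"
    unfolding sum.distrib sum_distrib_left[symmetric] sum_dirac
    unfolding sum.distrib[symmetric] by (intro sum.cong) auto
  also have "\<dots> = (\<Sum>i=1..k. eps i * dirac d (sx i) * X i + dirac d 0 * Y i + dirac d i * Z i)"
    unfolding gF_sym[of x _ d] by (intro sum.cong) (simp_all add: gF_v gF_s)
  finally show ?thesis .
qed

lemma has_pd_Chr:
  "has_pd (\<lambda>y. Chr N g y e b c) a x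
    (\<Sum>i=1..k. dirac e (sx i) * (eps i * (dirac a 0 * (dirac b i * dirac c i)
          - deriv (f i) (x i) * dirac a i * (dirac b 0 * dirac c i + dirac b i * dirac c 0)))
     + dirac e (vx 0) * ((2 * deriv (deriv (f i)) (x i) * dirac a i * x (sx i)
             + (2 * deriv (f i) (x i) + 1) * dirac a (sx i)) * (dirac b i * dirac c i)
         + deriv (f i) (x i) * dirac a i * (dirac b i * dirac c (sx i) + dirac b (sx i) * dirac c i))
     + dirac e (vx i) * (deriv (f i) (x i) * dirac a i * (dirac b 0 * dirac c (sx i) + dirac b (sx i) * dirac c 0)
         - dirac a (sx i) * (dirac b 0 * dirac c i + dirac b i * dirac c 0)
         - dirac a 0 * (dirac b i * dirac c (sx i) + dirac b (sx i) * dirac c i)))"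
  unfolding Chr_eq Chr_s_def
  by (rule has_pd_eq_rhs, (rule has_pd_intros has_pd_compose DERIV_f | assumption)+)
     (intro sum.cong refl, simp add: algebra_simps)

text \<open>The sum over \<open>h\<close> sees only the upper s-index of the first factor, and a
  symbol with lower index s_i has only upper v-indices. The explicit zero term gives the sum the
  shape of \<open>has_pd_Chr\<close>, so that the two add term by term.\<close>

lemma Chr_Chr:
  "(\<Sum>h<N. Chr N g x h b c * Chr N g x e a h)
    = (\<Sum>i=1..k. dirac e (sx i) * 0
        + dirac e (vx 0) * (Chr_s x i (dirac b) (dirac c) * (f i (x i) * dirac a i))
        + dirac e (vx i) * (Chr_s x i (dirac b) (dirac c) * (f i (x i) * dirac a 0 - x 0 * dirac a i)))"
proof -
  \<comment> \<open>Regrouped by the lower index \<open>h\<close>, as \<open>Chr_contract\<close>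
    requires.\<close>
  have "Chr N g x e a h = (\<Sum>i=1..k.
      dirac h 0 * (- dirac e (sx i) * (eps i * f i (x i) * dirac a i)
          + dirac e (vx i) * (f i (x i) * dirac a (sx i) - x (sx i) * dirac a i))
    + dirac h i * (dirac e (sx i) * (eps i * (x 0 * dirac a i - f i (x i) * dirac a 0))
          + dirac e (vx 0) * ((2 * deriv (f i) (x i) + 1) * x (sx i) * dirac a i + f i (x i) * dirac a (sx i))
          - dirac e (vx i) * (x (sx i) * dirac a 0 + x 0 * dirac a (sx i)))
    + dirac h (sx i) * (dirac e (vx 0) * (f i (x i) * dirac a i)
          + dirac e (vx i) * (f i (x i) * dirac a 0 - x 0 * dirac a i)))" for h
    unfolding Chr_eq Chr_s_def by (intro sum.cong refl) (simp add: algebra_simps)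
  then have "(\<Sum>h<N. Chr N g x h b c * Chr N g x e a h) = (\<Sum>i=1..k. Chr_s x i (dirac b) (dirac c)
      * (dirac e (vx 0) * (f i (x i) * dirac a i)
          + dirac e (vx i) * (f i (x i) * dirac a 0 - x 0 * dirac a i)))"
    by (simp only: Chr_contract)
  then show ?thesis by (simp add: algebra_simps)
qed

text \<open>Derivatives of the symbols give f' + 1, the 1 coming from differentiating the explicit
  factors u_0 and s_i. Products of symbols give the coefficient eps f^2. Terms that still contain
  u_0 or s_i cancel on antisymmetrising in \<open>a\<close> and \<open>b\<close>.\<close>

lemma Rcomp_eq:
  "Rcomp N g x [a, b, c, d] = curv_form (\<lambda>i u. deriv (f i) u + 1) (\<lambda>i u. eps i * (f i u)\<^sup>2) x
     (map dirac [a, b, c, d])"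
proof -
  have "Rcomp N g x [a, b, c, d] = (\<Sum>e<N. g x e d *
      (pd (\<lambda>y. Chr N g y e b c) a x - pd (\<lambda>y. Chr N g y e a c) b x
        + ((\<Sum>h<N. Chr N g x h b c * Chr N g x e a h) - (\<Sum>h<N. Chr N g x h a c * Chr N g x e b h))))"
    by (simp add: Rcomp_def sum_subtractf)
  also have "\<dots> = (\<Sum>e<N. g x e d * (\<Sum>i=1..k.
      dirac e (sx i) * (eps i * ((deriv (f i) (x i) + 1) * pf i (dirac a) (dirac b) * dirac c i))
    + dirac e (vx 0) * ((deriv (f i) (x i) + 1) * (dirac a (sx i) * dirac b i - dirac a i * dirac b (sx i)) * dirac c i
          + eps i * (f i (x i))\<^sup>2 * pf i (dirac a) (dirac b) * dirac c i)
    + dirac e (vx i) * ((deriv (f i) (x i) + 1) * (rf i (dirac a) (dirac b) * dirac c 0 - pf i (dirac a) (dirac b) * dirac c (sx i))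
          - eps i * (f i (x i))\<^sup>2 * pf i (dirac a) (dirac b) * dirac c 0)))"
    unfolding has_pd_Chr[THEN has_pd_imp_pd] Chr_Chr
    unfolding sum.distrib[symmetric] sum_subtractf[symmetric]
    by (intro sum.cong refl arg_cong2[where f = "(*)"])
       (simp add: Chr_s_def pf_def rf_def algebra_simps power2_eq_square)
  also have "\<dots> = curv_form (\<lambda>i u. deriv (f i) u + 1) (\<lambda>i u. eps i * (f i u)\<^sup>2) x
     (map dirac [a, b, c, d])"
    unfolding gF_contract list.map curv_form_Cons
  proof (intro sum.cong refl, goal_cases)
    case (1 i)
    have eps_eps: "eps i * (eps i * E) = E" for E
      using eps_sq[OF 1] by (simp add: mult.assoc[symmetric])
    show ?case by (simp add: pf_def rf_def algebra_simps eps_eps)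
  qed
  finally show ?thesis .
qed

text \<open>Only the coefficient of \<open>dirac h (sx i)\<close> survives. In the four curvature
  slots it comes from \<open>rf\<close> alone, so \<open>B\<close> drops out; a differentiation slot
  reads no s-component and contributes zero.\<close>

lemma Chr_contract_curv_form:
  fixes A B x ts
  defines "F \<equiv> curv_form A B x" and "\<Theta> \<equiv> \<lambda>i. \<Prod>t\<leftarrow>map dirac ts. t i"
  shows "(\<Sum>h<N. Chr N g x h t a * F (map dirac (h # b # c # d # ts)))
      = (\<Sum>i=1..k. Chr_s x i (dirac t) (dirac a)
          * (- A i (x i) * dirac b i * pf i (dirac c) (dirac d) * \<Theta> i))" (is ?th1)
    and "(\<Sum>h<N. Chr N g x h t b * F (map dirac (a # h # c # d # ts)))
      = (\<Sum>i=1..k. Chr_s x i (dirac t) (dirac b)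
          * (A i (x i) * dirac a i * pf i (dirac c) (dirac d) * \<Theta> i))" (is ?th2)
    and "(\<Sum>h<N. Chr N g x h t c * F (map dirac (a # b # h # d # ts)))
      = (\<Sum>i=1..k. Chr_s x i (dirac t) (dirac c)
          * (- A i (x i) * dirac d i * pf i (dirac a) (dirac b) * \<Theta> i))" (is ?th3)
    and "(\<Sum>h<N. Chr N g x h t d * F (map dirac (a # b # c # h # ts)))
      = (\<Sum>i=1..k. Chr_s x i (dirac t) (dirac d)
          * (A i (x i) * dirac c i * pf i (dirac a) (dirac b) * \<Theta> i))" (is ?th4)
    and "j < length ts \<Longrightarrow>
      (\<Sum>h<N. Chr N g x h t e * F (map dirac (a # b # c # d # ts[j := h]))) = 0" (is "_ \<Longrightarrow> ?th5")
proof -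
  have "F (map dirac (h # b # c # d # ts)) = (\<Sum>i=1..k.
      dirac h 0 * ((A i (x i) * rf i (dirac c) (dirac d) - B i (x i) * pf i (dirac c) (dirac d)) * dirac b i * \<Theta> i)
    + dirac h i * ((A i (x i) * (dirac b (sx i) * pf i (dirac c) (dirac d) - dirac b 0 * rf i (dirac c) (dirac d))
          + B i (x i) * dirac b 0 * pf i (dirac c) (dirac d)) * \<Theta> i)
    + dirac h (sx i) * (- A i (x i) * dirac b i * pf i (dirac c) (dirac d) * \<Theta> i))" for h
    unfolding F_def list.map curv_form_Cons \<Theta>_def pf_def[of _ "dirac h"] rf_def[of _ "dirac h"]
    by (intro sum.cong refl) (simp add: algebra_simps)
  then show ?th1 by (simp only: Chr_contract)
  have "F (map dirac (a # h # c # d # ts)) = (\<Sum>i=1..k.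
      dirac h 0 * ((B i (x i) * pf i (dirac c) (dirac d) - A i (x i) * rf i (dirac c) (dirac d)) * dirac a i * \<Theta> i)
    + dirac h i * ((A i (x i) * (dirac a 0 * rf i (dirac c) (dirac d) - dirac a (sx i) * pf i (dirac c) (dirac d))
          - B i (x i) * dirac a 0 * pf i (dirac c) (dirac d)) * \<Theta> i)
    + dirac h (sx i) * (A i (x i) * dirac a i * pf i (dirac c) (dirac d) * \<Theta> i))" for h
    unfolding F_def list.map curv_form_Cons \<Theta>_def pf_def[of _ _ "dirac h"] rf_def[of _ _ "dirac h"]
    by (intro sum.cong refl) (simp add: algebra_simps)
  then show ?th2 by (simp only: Chr_contract)
  have "F (map dirac (a # b # h # d # ts)) = (\<Sum>i=1..k.
      dirac h 0 * ((A i (x i) * rf i (dirac a) (dirac b) - B i (x i) * pf i (dirac a) (dirac b)) * dirac d i * \<Theta> i)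
    + dirac h i * ((A i (x i) * (dirac d (sx i) * pf i (dirac a) (dirac b) - dirac d 0 * rf i (dirac a) (dirac b))
          + B i (x i) * dirac d 0 * pf i (dirac a) (dirac b)) * \<Theta> i)
    + dirac h (sx i) * (- A i (x i) * dirac d i * pf i (dirac a) (dirac b) * \<Theta> i))" for h
    unfolding F_def list.map curv_form_Cons \<Theta>_def pf_def[of _ "dirac h"] rf_def[of _ "dirac h"]
    by (intro sum.cong refl) (simp add: algebra_simps)
  then show ?th3 by (simp only: Chr_contract)
  have "F (map dirac (a # b # c # h # ts)) = (\<Sum>i=1..k.
      dirac h 0 * ((B i (x i) * pf i (dirac a) (dirac b) - A i (x i) * rf i (dirac a) (dirac b)) * dirac c i * \<Theta> i)
    + dirac h i * ((A i (x i) * (dirac c 0 * rf i (dirac a) (dirac b) - dirac c (sx i) * pf i (dirac a) (dirac b))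
          - B i (x i) * dirac c 0 * pf i (dirac a) (dirac b)) * \<Theta> i)
    + dirac h (sx i) * (A i (x i) * dirac c i * pf i (dirac a) (dirac b) * \<Theta> i))" for h
    unfolding F_def list.map curv_form_Cons \<Theta>_def pf_def[of _ _ "dirac h"] rf_def[of _ _ "dirac h"]
    by (intro sum.cong refl) (simp add: algebra_simps)
  then show ?th4 by (simp only: Chr_contract)
  assume j: "j < length ts"
  \<comment> \<open>The product over the differentiation slots with the j-th factor removed.\<close>
  define \<Theta>' where "\<Theta>' i = (\<Prod>t\<leftarrow>map dirac (take j ts). t i) * (\<Prod>t\<leftarrow>map dirac (drop (Suc j) ts). t i)" for i
  have "(\<Prod>t\<leftarrow>map dirac (ts[j := h]). t i) = dirac h i * \<Theta>' i" for h i
    by (simp add: upd_conv_take_nth_drop[OF j] \<Theta>'_def mult_ac)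
  then have "F (map dirac (a # b # c # d # ts[j := h])) = (\<Sum>i=1..k. dirac h 0 * 0
    + dirac h i * ((A i (x i) * (pf i (dirac a) (dirac b) * rf i (dirac c) (dirac d)
          + rf i (dirac a) (dirac b) * pf i (dirac c) (dirac d))
        - B i (x i) * (pf i (dirac a) (dirac b) * pf i (dirac c) (dirac d))) * \<Theta>' i)
    + dirac h (sx i) * 0)" for h
    unfolding F_def list.map(2) curv_form_Cons
    by (intro sum.cong refl) (simp only: mult_ac mult_zero_left add_0 add_0_right)
  then have "(\<Sum>h<N. Chr N g x h t e * F (map dirac (a # b # c # d # ts[j := h])))
    = (\<Sum>i=1..k. Chr_s x i (dirac t) (dirac e) * 0)"
    by (simp only: Chr_contract)
  then show ?th5 by simp
qed

text \<open>The contractions in slots 1 and 2 add up to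
  \<open>eps i * f i (x i) * A i (x i) * dirac t i\<close> times both \<open>pf\<close> factors, the
  terms in u_0 cancelling; slots 3 and 4 give the same. \<open>covD\<close> subtracts these, and
  since \<open>B\<close> enters \<open>curv_form\<close> with a minus sign they increase
  \<open>B\<close>.\<close>

lemma covD_curv_form:
  assumes T: "\<And>y idx. length idx = 4 + m \<Longrightarrow> T y idx = curv_form A B y (map dirac idx)"
    and A: "\<And>i u. i \<in> {1..k} \<Longrightarrow> (A i has_real_derivative A' i u) (at u)"
    and B: "\<And>i u. i \<in> {1..k} \<Longrightarrow> (B i has_real_derivative B' i u) (at u)"
    and idx: "length idx = 4 + Suc m"
  shows "covD N g T x idx = curv_form A' (\<lambda>i u. B' i u + 2 * eps i * f i u * A i u) x (map dirac idx)"
proof -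
  obtain a b c d ts t where idx_eq: "idx = (a # b # c # d # ts) @ [t]" and ts: "length ts = m"
  proof -
    obtain idx' t where "idx = idx' @ [t]" "length idx' = 4 + m"
      using idx by (cases idx rule: rev_cases) auto
    moreover then obtain a b c d ts where "idx' = a # b # c # d # ts" "length ts = m"
      by (auto simp: length_Suc_conv numeral_eq_Suc)
    ultimately show ?thesis using that by blast
  qed
  define \<Theta> where "\<Theta> i = (\<Prod>t\<leftarrow>map dirac ts. t i)" for i
  have upd: "T x ((a # b # c # d # ts)[j := h]) = curv_form A B x (map dirac ((a # b # c # d # ts)[j := h]))" for j h
    by (rule T) (simp only: length_list_update, simp add: ts)
  have "has_pd (\<lambda>y. T y (a # b # c # d # ts)) t x (\<Sum>i=1..k. dirac t i *
      (A' i (x i) * (pf i (dirac a) (dirac b) * rf i (dirac c) (dirac d)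
          + rf i (dirac a) (dirac b) * pf i (dirac c) (dirac d))
        - B' i (x i) * (pf i (dirac a) (dirac b) * pf i (dirac c) (dirac d))) * \<Theta> i)"
  proof -
    have "(\<lambda>y. T y (a # b # c # d # ts)) = (\<lambda>y. curv_form A B y (map dirac (a # b # c # d # ts)))"
      using T ts by auto
    then show ?thesis
      unfolding list.map curv_form_Cons \<Theta>_def
      by (simp only:)
         (rule has_pd_eq_rhs, (rule has_pd_intros has_pd_compose A B | assumption)+,
          intro sum.cong refl, simp add: algebra_simps)
  qed
  note deriv_T = has_pd_imp_pd[OF this]
  have "covD N g T x idx = pd (\<lambda>y. T y (a # b # c # d # ts)) t x
      - (\<Sum>j<length (a # b # c # d # ts). \<Sum>h<N. Chr N g x h t ((a # b # c # d # ts) ! j)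
          * curv_form A B x (map dirac ((a # b # c # d # ts)[j := h])))"
    unfolding covD_def idx_eq Let_def butlast_snoc last_snoc upd ..
  also have "(\<Sum>j<length (a # b # c # d # ts). \<Sum>h<N. Chr N g x h t ((a # b # c # d # ts) ! j)
          * curv_form A B x (map dirac ((a # b # c # d # ts)[j := h])))
     = (\<Sum>h<N. Chr N g x h t a * curv_form A B x (map dirac (h # b # c # d # ts)))
     + ((\<Sum>h<N. Chr N g x h t b * curv_form A B x (map dirac (a # h # c # d # ts)))
     + ((\<Sum>h<N. Chr N g x h t c * curv_form A B x (map dirac (a # b # h # d # ts)))
     + ((\<Sum>h<N. Chr N g x h t d * curv_form A B x (map dirac (a # b # c # h # ts)))
     + (\<Sum>j<length ts. \<Sum>h<N. Chr N g x h t (ts ! j)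
          * curv_form A B x (map dirac (a # b # c # d # ts[j := h]))))))"
    by (simp only: list.size(4) add_Suc_right add_0_right sum.lessThan_Suc_shift nth_Cons_0 nth_Cons_Suc
        list_update_code)
  also have "\<dots> = (\<Sum>i=1..k. 2 * eps i * f i (x i) * A i (x i) * dirac t i
      * (pf i (dirac a) (dirac b) * pf i (dirac c) (dirac d)) * \<Theta> i)"
  proof -
    have z: "(\<Sum>j<length ts. \<Sum>h<N. Chr N g x h t (ts ! j)
          * curv_form A B x (map dirac (a # b # c # d # ts[j := h]))) = 0"
      by (intro sum.neutral ballI Chr_contract_curv_form(5)) simp
    show ?thesis
      unfolding Chr_contract_curv_form(1-4) z \<Theta>_def[symmetric]
      unfolding add_0_right sum.distrib[symmetric]
      by (intro sum.cong refl) (simp add: Chr_s_def pf_def algebra_simps)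
  qed
  finally show ?thesis
    unfolding deriv_T idx_eq append_Cons list.map curv_form_Cons sum_subtractf[symmetric]
    by (simp only:) (intro sum.cong refl, simp add: \<Theta>_def algebra_simps)
qed

lemma curv_form_cong:
  assumes "\<And>i. i \<in> {1..k} \<Longrightarrow> A i (x i) = A' i (x i)" "\<And>i. i \<in> {1..k} \<Longrightarrow> B i (x i) = B' i (x i)"
  shows "curv_form A B x vs = curv_form A' B' x vs"
  unfolding curv_form_def by (auto split: list.split simp: assms)

text \<open>\<open>rho\<close>, \<open>rho1\<close> and \<open>rho2\<close> are the coefficients
  \<open>B\<close> for the curvature tensor and its first two covariant derivatives, obtained by
  iterating \<open>covD_curv_form\<close>.\<close>

definition rho :: "nat \<Rightarrow> real \<Rightarrow> real" where
  "rho i u = eps i * (f i u)\<^sup>2"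

definition rho1 :: "nat \<Rightarrow> real \<Rightarrow> real" where
  "rho1 i u = 2 * eps i * f i u * (2 * deriv (f i) u + 1)"

definition rho2 :: "nat \<Rightarrow> real \<Rightarrow> real" where
  "rho2 i u = 2 * eps i * (deriv (f i) u * (2 * deriv (f i) u + 1) + f i u * (2 * deriv (deriv (f i)) u))
     + 2 * eps i * f i u * deriv (deriv (f i)) u"

lemma nablaR_0:
  assumes "length idx = 4"
  shows "nablaR N g 0 x idx = curv_form (\<lambda>i u. deriv (f i) u + 1) rho x (map dirac idx)"
proof -
  obtain a b c d where "idx = [a, b, c, d]"
    using assms by (auto simp: length_Suc_conv numeral_eq_Suc)
  then show ?thesis
    using Rcomp_eq[of x a b c d] by (simp add: rho_def[abs_def])
qed

lemma nablaR_1: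
  assumes "length idx = 5"
  shows "nablaR N g 1 x idx = curv_form (\<lambda>i. deriv (deriv (f i))) rho1 x (map dirac idx)"
proof -
  have "nablaR N g 1 x idx = covD N g (nablaR N g 0) x idx" by simp
  also have "\<dots> = curv_form (\<lambda>i. deriv (deriv (f i)))
      (\<lambda>i u. 2 * eps i * f i u * deriv (f i) u + 2 * eps i * f i u * (deriv (f i) u + 1)) x (map dirac idx)"
  proof (rule covD_curv_form[where m = 0])
    fix i u assume i: "i \<in> {1..k}"
    show "((\<lambda>u. deriv (f i) u + 1) has_real_derivative deriv (deriv (f i)) u) (at u)"
      by (auto intro!: derivative_eq_intros DERIV_f[OF i])
    show "(rho i has_real_derivative 2 * eps i * f i u * deriv (f i) u) (at u)"
      unfolding rho_def[abs_def] by (auto intro!: derivative_eq_intros DERIV_f[OF i])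
  qed (use assms nablaR_0 in auto)
  also have "\<dots> = curv_form (\<lambda>i. deriv (deriv (f i))) rho1 x (map dirac idx)"
    by (rule curv_form_cong) (auto simp: rho1_def algebra_simps)
  finally show ?thesis .
qed

lemma nablaR_2:
  assumes "length idx = 6"
  shows "nablaR N g 2 x idx = curv_form (\<lambda>i. deriv (deriv (deriv (f i)))) rho2 x (map dirac idx)"
proof -
  have "nablaR N g 2 x idx = covD N g (nablaR N g 1) x idx" by (simp add: numeral_2_eq_2)
  also have "\<dots> = curv_form (\<lambda>i. deriv (deriv (deriv (f i))))
      (\<lambda>i u. 2 * eps i * (deriv (f i) u * (2 * deriv (f i) u + 1) + f i u * (2 * deriv (deriv (f i)) u))
        + 2 * eps i * f i u * deriv (deriv (f i)) u) x (map dirac idx)"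
  proof (rule covD_curv_form[where m = 1])
    fix i u assume i: "i \<in> {1..k}"
    show "(deriv (deriv (f i)) has_real_derivative deriv (deriv (deriv (f i))) u) (at u)"
      by (rule DERIV_f[OF i])
    show "(rho1 i has_real_derivative
        2 * eps i * (deriv (f i) u * (2 * deriv (f i) u + 1) + f i u * (2 * deriv (deriv (f i)) u))) (at u)"
      unfolding rho1_def[abs_def]
      by (auto intro!: derivative_eq_intros DERIV_f[OF i] simp: algebra_simps)
  qed (use assms nablaR_1 in auto)
  finally show ?thesis unfolding rho2_def[abs_def] .
qed

section \<open>Passage from components to multilinear forms\<close>

text \<open>Linearity in the form in which it is applied: a value is recovered from those on the
  coordinate vectors. It may be demanded of all functions \<open>v\<close>, as the forms concerned
  read only coordinates below \<open>N\<close>.\<close>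

definition coord_linear :: "((nat \<Rightarrow> real) \<Rightarrow> real) \<Rightarrow> bool" where
  "coord_linear L \<longleftrightarrow> (\<forall>v. (\<Sum>a<N. v a * L (dirac a)) = L v)"

lemma coord_linearD: "coord_linear L \<Longrightarrow> (\<Sum>a<N. v a * L (dirac a)) = L v"
  by (simp add: coord_linear_def)

lemma coord_linear_coord: "j < N \<Longrightarrow> coord_linear (\<lambda>v. v j)"
  by (simp add: coord_linear_def sum_dirac)

lemma coord_linear_add:
  "coord_linear L \<Longrightarrow> coord_linear L' \<Longrightarrow> coord_linear (\<lambda>v. L v + L' v)"
  by (simp add: coord_linear_def distrib_left sum.distrib)

lemma coord_linear_diff:
  "coord_linear L \<Longrightarrow> coord_linear L' \<Longrightarrow> coord_linear (\<lambda>v. L v - L' v)"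
  by (simp add: coord_linear_def right_diff_distrib sum_subtractf)

lemma coord_linear_scale: "coord_linear L \<Longrightarrow> coord_linear (\<lambda>v. c * L v)"
  by (simp add: coord_linear_def mult.left_commute sum_distrib_left[symmetric])

lemma coord_linear_scale_right: "coord_linear L \<Longrightarrow> coord_linear (\<lambda>v. L v * c)"
  using coord_linear_scale[of L c] by (simp add: mult.commute)

lemma coord_linear_sum:
  assumes "\<And>i. i \<in> A \<Longrightarrow> coord_linear (L i)"
  shows "coord_linear (\<lambda>v. \<Sum>i\<in>A. L i v)"
  unfolding coord_linear_def
proof
  fix v
  have "(\<Sum>a<N. v a * (\<Sum>i\<in>A. L i (dirac a))) = (\<Sum>i\<in>A. \<Sum>a<N. v a * L i (dirac a))"
    unfolding sum_distrib_left by (rule sum.swap)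
  also have "\<dots> = (\<Sum>i\<in>A. L i v)"
    by (intro sum.cong refl coord_linearD assms)
  finally show "(\<Sum>a<N. v a * (\<Sum>i\<in>A. L i (dirac a))) = (\<Sum>i\<in>A. L i v)" .
qed

lemmas coord_linear_intros =
  coord_linear_sum coord_linear_add coord_linear_diff coord_linear_scale coord_linear_scale_right
  coord_linear_coord

lemma coord_linear_curv_form:
  "coord_linear (\<lambda>v. curv_form A B x (v # b # c # d # ts))"
  "coord_linear (\<lambda>v. curv_form A B x (a # v # c # d # ts))"
  "coord_linear (\<lambda>v. curv_form A B x (a # b # v # d # ts))"
  "coord_linear (\<lambda>v. curv_form A B x (a # b # c # v # ts))"
  unfolding curv_form_Cons pf_def rf_def by (intro coord_linear_intros; simp)+

lemma coord_linear_gform: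
  "coord_linear (\<lambda>v. gform x v w)" "coord_linear (\<lambda>w. gform x v w)"
  unfolding gform_def by (intro coord_linear_intros; simp)+

lemma gval_eq: "gval N g x v w = gform x v w"
proof -
  have "gval N g x v w = (\<Sum>a<N. v a * (\<Sum>b<N. w b * gform x (dirac a) (dirac b)))"
    by (simp add: gval_def gF_eq_gform sum_distrib_left mult_ac)
  also have "\<dots> = gform x v w"
    by (simp only: coord_linear_gform[THEN coord_linearD])
  finally show ?thesis .
qed

text \<open>Linearity handles the four curvature slots; the others form a tensor power in each
  block, so \<open>teval_prod_dirac\<close> applies.\<close>

lemma teval_eq:
  assumes "length vs = 4 + m"
    and T: "\<And>idx. length idx = 4 + m \<Longrightarrow> T x idx = curv_form A B x (map dirac idx)"
  shows "teval N T x vs = curv_form A B x vs"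
proof -
  obtain a b c d ts where vs: "vs = a # b # c # d # ts"
    using assms(1) by (auto simp: length_Suc_conv numeral_eq_Suc)
  have tail: "teval N (\<lambda>y idx. curv_form A B x (a # b # c # d # map dirac idx)) x ts
      = curv_form A B x (a # b # c # d # ts)" for a b c d
    unfolding curv_form_Cons teval_sum teval_scale
    by (intro sum.cong refl arg_cong2[where f = "(*)"] teval_prod_dirac) simp
  have "teval N T x vs = teval N (\<lambda>y idx. curv_form A B x (map dirac idx)) x vs"
    unfolding teval_def by (intro sum.cong) (auto simp: assms)
  also have "\<dots> = curv_form A B x vs"
    unfolding vs teval_Cons list.map tail
    by (simp only: coord_linear_curv_form[THEN coord_linearD])
  finally show ?thesis .
qed

lemma teval_nablaR:
  "length vs = 4 \<Longrightarrow> teval N (nablaR N g 0) x vs = curv_form (\<lambda>i u. deriv (f i) u + 1) rho x vs"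
  "length vs = 5 \<Longrightarrow> teval N (nablaR N g 1) x vs = curv_form (\<lambda>i. deriv (deriv (f i))) rho1 x vs"
  "length vs = 6 \<Longrightarrow> teval N (nablaR N g 2) x vs = curv_form (\<lambda>i. deriv (deriv (deriv (f i)))) rho2 x vs"
  subgoal by (intro teval_eq[where m = 0] nablaR_0; simp)
  subgoal by (intro teval_eq[where m = 1] nablaR_1; simp)
  subgoal by (intro teval_eq[where m = 2] nablaR_2; simp)
  done

section \<open>Invariants of isometries that preserve the curvature tensors\<close>

text \<open>Eliminates the entries of an isometry. By E1 to E3, up to the common factor
  \<open>\<omega>\<close>, the triple a, b, c scales by \<open>\<mu>\<close> times y^2, y^3, y^4, so
  ac/b^2 is scale free.\<close>

lemma block_invariants_algebra:
  fixes a b c :: real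
  assumes nz: "a \<noteq> 0" "b \<noteq> 0" "a' \<noteq> 0" "b' \<noteq> 0" "\<mu> \<noteq> 0" "y \<noteq> 0" and \<omega>: "\<omega>\<^sup>2 = 1"
    and E1: "\<omega> * a = \<mu> * y\<^sup>2 * a'" and E2: "\<omega> * b = \<mu> * y^3 * b'" and E3: "\<omega> * c = \<mu> * y^4 * c'"
    and E4: "C * \<omega> * a = \<mu> * y * a'"
    and E5: "p * C = (2 * a' * \<mu> * \<xi> + p' * \<mu>\<^sup>2) * y"
    and E6: "q * C = (2 * b' * \<mu> * \<xi> + q' * \<mu>\<^sup>2) * y\<^sup>2"
  shows "a * c / b\<^sup>2 = a' * c' / b'\<^sup>2"
    and "(q * a - p * b) * b / a ^ 4 = (q' * a' - p' * b') * b' / a' ^ 4"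
proof -
  have "(\<omega> * a) * (\<omega> * c) * (\<mu> * y^3 * b')\<^sup>2 = (\<mu> * y\<^sup>2 * a') * (\<mu> * y^4 * c') * (\<omega> * b)\<^sup>2"
    unfolding E1 E2 E3 ..
  then have "(\<mu> * y^3)\<^sup>2 * (\<omega>\<^sup>2 * (a * c * b'\<^sup>2)) = (\<mu> * y^3)\<^sup>2 * (\<omega>\<^sup>2 * (a' * c' * b\<^sup>2))"
    by algebra
  then have "a * c * b'\<^sup>2 = a' * c' * b\<^sup>2"
    using nz \<omega> by simp
  then show "a * c / b\<^sup>2 = a' * c' / b'\<^sup>2"
    using nz by (simp add: frac_eq_eq)
  have "\<mu> * y\<^sup>2 * (y * b' * a) = \<mu> * y\<^sup>2 * (a' * b)"
    using E1 E2 by algebra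
  \<comment> \<open>The quotient of E2 by E1.\<close>
  then have R: "y * b' * a = a' * b"
    using nz by simp
  have "\<mu> * y * a' * (C * y) = \<mu> * y * a' * 1"
    using E1 E4 by algebra
  then have C: "C * y = 1"
    using nz by (simp only: mult_cancel_left) auto
  have p: "p = (2 * a' * \<mu> * \<xi> + p' * \<mu>\<^sup>2) * y\<^sup>2"
    using E5 C by algebra
  have q: "q = (2 * b' * \<mu> * \<xi> + q' * \<mu>\<^sup>2) * y^3"
    using E6 C by algebra
  \<comment> \<open>The two terms in \<open>\<xi>\<close> cancel by \<open>R\<close>.\<close>
  have "a' * (q * a - p * b) = \<mu>\<^sup>2 * y^3 * a * (q' * a' - p' * b')"
    unfolding p q using R by algebra
  then have "(q * a - p * b) * b * a' ^ 4 = (\<mu> * y\<^sup>2 * a')\<^sup>2 * a\<^sup>2 * ((q' * a' - p' * b') * b')"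
    using R by algebra
  also have "\<dots> = (q' * a' - p' * b') * b' * a ^ 4"
    unfolding E1[symmetric] using \<omega> by algebra
  finally show "(q * a - p * b) * b / a ^ 4 = (q' * a' - p' * b') * b' / a' ^ 4"
    using nz by (simp add: frac_eq_eq)
qed

lemma dirac_simps:
  "dirac 0 0 = 1" "i \<in> {1..k} \<Longrightarrow> dirac 0 i = 0" "dirac 0 (sx i) = 0"
  "i \<in> {1..k} \<Longrightarrow> dirac i 0 = 0" "i \<in> {1..k} \<Longrightarrow> dirac i (sx n) = 0"
  "j \<le> k \<Longrightarrow> dirac (sx i) j = 0" "i \<in> {1..k} \<Longrightarrow> j \<le> k \<Longrightarrow> dirac (sx i) (vx j) = 0"
  "dirac (sx i) (sx n) = dirac i n"
  "j' \<le> k \<Longrightarrow> dirac (vx j) j' = 0" "i \<in> {1..k} \<Longrightarrow> j \<le> k \<Longrightarrow> dirac (vx j) (sx i) = 0"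
  by (auto simp: dirac_def coord_defs)

lemma sum_block:
  assumes "n \<in> {1..k}"
  shows "(\<Sum>m=1..k. h m * dirac n m) = h n"
  using assms by (simp only: sum_dirac_u) simp

text \<open>First test pattern: a last curvature argument without u-components makes the second
  \<open>pf\<close> vanish, which isolates \<open>A\<close>.\<close>

lemma curv_form_sum1:
  assumes "\<And>m. m \<in> {1..k} \<Longrightarrow> a m = 0" "\<And>j. j \<le> k \<Longrightarrow> w j = 0"
  shows "curv_form A B x (a # b # c # w # ts)
    = (\<Sum>m=1..k. a 0 * b m * c m * w (sx m) * (A m (x m) * (\<Prod>t\<leftarrow>ts. t m)))"
  unfolding curv_form_Cons by (intro sum.cong refl) (simp add: pf_def rf_def assms)

text \<open>Second test pattern: repeating \<open>a\<close> brings in \<open>B\<close>, together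
  with a multiple of \<open>A\<close> from the s-component of \<open>a\<close>.\<close>

lemma curv_form_sum2:
  assumes "\<And>m. m \<in> {1..k} \<Longrightarrow> a m = 0"
  shows "curv_form A B x (a # b # c # a # ts)
    = (\<Sum>m=1..k. (2 * A m (x m) * a 0 * a (sx m) + B m (x m) * (a 0)\<^sup>2) * b m * c m * (\<Prod>t\<leftarrow>ts. t m))"
  unfolding curv_form_Cons
  by (intro sum.cong refl) (simp add: pf_def rf_def assms algebra_simps power2_eq_square)

text \<open>A vector in the kernel of the curvature tensor has only v-components, as far as block
  \<open>n\<close> is concerned. The test arguments isolate one component times
  \<open>A n (x n)\<close>.\<close>

lemma curv_form_null:
  assumes "n \<in> {1..k}" "A n (x n) \<noteq> 0"
    and null: "\<And>b c d. {b, c, d} \<subseteq> pts N \<Longrightarrow> curv_form A B x [y, b, c, d] = 0"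
  shows "y 0 = 0" "y n = 0" "y (sx n) = 0"
proof -
  have in_pts: "dirac 0 \<in> pts N" "dirac n \<in> pts N" "dirac (sx n) \<in> pts N"
    using assms(1) by (auto simp: pts_def dirac_def coord_defs)
  have "curv_form A B x [y, dirac n, dirac n, dirac (sx n)] = (\<Sum>m=1..k. y 0 * A m (x m) * dirac n m)"
    unfolding curv_form_Cons
    by (intro sum.cong refl) (use assms(1) in \<open>auto simp: pf_def rf_def dirac_simps, auto simp: dirac_def split: if_splits\<close>)
  then show y0: "y 0 = 0"
    using null[of "dirac n" "dirac n" "dirac (sx n)"] in_pts assms(2) unfolding sum_block[OF assms(1)] by auto
  have "curv_form A B x [y, dirac (sx n), dirac 0, dirac n] = (\<Sum>m=1..k. y m * A m (x m) * dirac n m)"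
    unfolding curv_form_Cons
    by (intro sum.cong refl) (use assms(1) in \<open>auto simp: pf_def rf_def dirac_simps, auto simp: dirac_def split: if_splits\<close>)
  then show "y n = 0"
    using null[of "dirac (sx n)" "dirac 0" "dirac n"] in_pts assms(2) unfolding sum_block[OF assms(1)] by auto
  \<comment> \<open>Here \<open>B\<close> would enter with the factor \<open>y 0\<close>, already
    known to vanish.\<close>
  have "curv_form A B x [y, dirac n, dirac 0, dirac n] = (\<Sum>m=1..k. - (y (sx m) * A m (x m)) * dirac n m)"
    unfolding curv_form_Cons
    by (intro sum.cong refl) (use assms(1) y0 in \<open>auto simp: pf_def rf_def dirac_simps, auto simp: dirac_def split: if_splits\<close>)
  then show "y (sx n) = 0"
    using null[of "dirac n" "dirac 0" "dirac n"] in_pts assms(2) unfolding sum_block[OF assms(1)] by auto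
qed

text \<open>An isometry matches the blocks of the two points up to a permutation, and rescales the data
  of matching blocks in a way that leaves both expressions unchanged. The combination
  of \<open>B0\<close> and \<open>B1\<close> is chosen so that the components of \<open>\<Phi> \<partial>\<^sub>u\<^sub>0\<close> along the \<open>\<partial>\<^sub>s\<close> cancel.\<close>

lemma block_invariants:
  fixes \<Phi> :: "(nat \<Rightarrow> real) \<Rightarrow> nat \<Rightarrow> real"
  assumes A0: "\<And>n x. n \<in> {1..k} \<Longrightarrow> A0 n x \<noteq> (0::real)"
    and A1: "\<And>n x. n \<in> {1..k} \<Longrightarrow> A1 n x \<noteq> (0::real)"
    and bij: "bij_betw \<Phi> (pts N) (pts N)"
    and iso: "\<And>v w. {v, w} \<subseteq> pts N \<Longrightarrow> gform Q (\<Phi> v) (\<Phi> w) = gform P v w"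
    and F0: "\<And>a b c d. {a, b, c, d} \<subseteq> pts N \<Longrightarrow>
      curv_form A0 B0 Q [\<Phi> a, \<Phi> b, \<Phi> c, \<Phi> d] = curv_form A0 B0 P [a, b, c, d]"
    and F1: "\<And>a b c d t. {a, b, c, d, t} \<subseteq> pts N \<Longrightarrow>
      curv_form A1 B1 Q [\<Phi> a, \<Phi> b, \<Phi> c, \<Phi> d, \<Phi> t] = curv_form A1 B1 P [a, b, c, d, t]"
    and F2: "\<And>a b c d t t'. {a, b, c, d, t, t'} \<subseteq> pts N \<Longrightarrow>
      curv_form A2 B2 Q [\<Phi> a, \<Phi> b, \<Phi> c, \<Phi> d, \<Phi> t, \<Phi> t'] = curv_form A2 B2 P [a, b, c, d, t, t']"
    and i: "i \<in> {1..k}"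
  shows "\<exists>n\<in>{1..k}.
    A0 i (P i) * A2 i (P i) / (A1 i (P i))\<^sup>2 = A0 n (Q n) * A2 n (Q n) / (A1 n (Q n))\<^sup>2 \<and>
    (B1 i (P i) * A0 i (P i) - B0 i (P i) * A1 i (P i)) * A1 i (P i) / A0 i (P i) ^ 4
      = (B1 n (Q n) * A0 n (Q n) - B0 n (Q n) * A1 n (Q n)) * A1 n (Q n) / A0 n (Q n) ^ 4"
proof -
  have in_pts: "dirac j \<in> pts N" if "j < N" for j
    using that by (auto simp: pts_def dirac_def)
  have pts_simps: "dirac 0 \<in> pts N" "m \<in> {1..k} \<Longrightarrow> dirac m \<in> pts N" "m \<in> {1..k} \<Longrightarrow> dirac (sx m) \<in> pts N"
    "m \<le> k \<Longrightarrow> dirac (vx m) \<in> pts N" for m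
    by (auto intro!: in_pts)
  have \<Phi>_pts: "v \<in> pts N \<Longrightarrow> \<Phi> v \<in> pts N" for v
    using bij by (auto simp: bij_betw_def)
  have surj: "\<exists>v\<in>pts N. \<Phi> v = w" if "w \<in> pts N" for w
    using bij_betw_imp_surj_on[OF bij] that by (metis image_iff)

  \<comment> \<open>The v-directions lie in the kernel of the curvature tensor at \<open>P\<close>.
    As \<open>\<Phi>\<close> is surjective, their images lie in the kernel at
    \<open>Q\<close>.\<close>
  have v_null: "\<Phi> (dirac (vx j)) 0 = 0" "n \<in> {1..k} \<Longrightarrow> \<Phi> (dirac (vx j)) n = 0"
    "n \<in> {1..k} \<Longrightarrow> \<Phi> (dirac (vx j)) (sx n) = 0" if j: "j \<le> k" for j n
  proof -
    have null: "curv_form A0 B0 Q [\<Phi> (dirac (vx j)), b, c, d] = 0" if "{b, c, d} \<subseteq> pts N" for b c d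
    proof -
      obtain b' c' d' where *: "{b', c', d'} \<subseteq> pts N" "\<Phi> b' = b" "\<Phi> c' = c" "\<Phi> d' = d"
        using surj \<open>{b, c, d} \<subseteq> pts N\<close> by (metis insert_subset empty_subsetI)
      have "curv_form A0 B0 P [dirac (vx j), b', c', d'] = 0"
        unfolding curv_form_Cons by (intro sum.neutral) (simp add: pf_def rf_def dirac_simps j)
      then show ?thesis using F0[of "dirac (vx j)" b' c' d'] * pts_simps j by simp
    qed
    show "\<Phi> (dirac (vx j)) 0 = 0"
      using curv_form_null(1)[OF i A0[OF i] null] .
    show "n \<in> {1..k} \<Longrightarrow> \<Phi> (dirac (vx j)) n = 0" "n \<in> {1..k} \<Longrightarrow> \<Phi> (dirac (vx j)) (sx n) = 0"
      using curv_form_null(2,3)[OF _ A0 null] by auto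
  qed
  have v_null': "\<Phi> (dirac (vx j)) l = 0" if "j \<le> k" "l \<le> k" for j l
    using v_null(1)[OF that(1)] v_null(2)[OF that(1), of l] that(2) by (cases "l = 0") auto

  define X where "X = \<Phi> (dirac 0)"
  define Y where "Y = \<Phi> (dirac i)"
  define \<mu> where "\<mu> = X 0"
  \<comment> \<open>The differentiation slot of the first covariant derivative annihilates the u_0
    direction at \<open>P\<close>, hence \<open>X\<close> at \<open>Q\<close>; the test picks out
    \<open>A1 m (Q m) * X m\<close>.\<close>
  have X_u: "X m = 0" if m: "m \<in> {1..k}" for m
  proof -
    obtain a' b' d' where *: "{a', b', d'} \<subseteq> pts N" "\<Phi> a' = dirac 0" "\<Phi> b' = dirac m" "\<Phi> d' = dirac (sx m)"
      using surj pts_simps m by (metis insert_subset empty_subsetI)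
    have "curv_form A1 B1 P [a', b', b', d', dirac 0] = 0"
      unfolding curv_form_Cons by (intro sum.neutral) (simp add: dirac_simps)
    then have "curv_form A1 B1 Q [dirac 0, dirac m, dirac m, dirac (sx m), X] = 0"
      using F1[of a' b' b' d' "dirac 0"] * pts_simps unfolding X_def by simp
    moreover have "curv_form A1 B1 Q [dirac 0, dirac m, dirac m, dirac (sx m), X]
        = (\<Sum>l=1..k. (A1 l (Q l) * X l) * dirac m l)"
      by (subst curv_form_sum1)
         (use m in \<open>auto simp: dirac_simps intro!: sum.cong, auto simp: dirac_def split: if_splits\<close>)
    ultimately show ?thesis using A1[OF m] unfolding sum_block[OF m] by simp
  qed
  \<comment> \<open>Otherwise \<open>X\<close> would have no u-components and be orthogonal to the
    image of the v_0 direction, whereas u_0 and v_0 pair to 1.\<close>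
  have \<mu>: "\<mu> \<noteq> 0"
  proof
    assume "\<mu> = 0"
    then have "X j = 0" if "j \<le> k" for j
      using X_u[of j] that unfolding \<mu>_def by (cases "j = 0") auto
    then have "gform Q X (\<Phi> (dirac (vx 0))) = 0"
      unfolding gform_def using v_null[of 0] v_null'[of 0] by (auto intro!: sum.neutral)
    moreover have "gform P (dirac 0) (dirac (vx 0)) = 1"
      using gF_v[of 0 P 0] unfolding gF_eq_gform by (simp add: dirac_def)
    ultimately show False
      using iso[of "dirac 0" "dirac (vx 0)"] pts_simps unfolding X_def by simp
  qed

  \<comment> \<open>The matching block: \<open>Y\<close> must have a u-component, because the first
    covariant derivative does not vanish with \<open>Y\<close> in its differentiation slot.\<close>
  obtain n where n: "n \<in> {1..k}" and Y_n: "Y n \<noteq> 0"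
  proof -
    have "curv_form A1 B1 P [dirac 0, dirac i, dirac i, dirac (sx i), dirac i]
        = (\<Sum>l=1..k. A1 l (P l) * dirac i l)"
      by (subst curv_form_sum1)
         (use i in \<open>auto simp: dirac_simps intro!: sum.cong, auto simp: dirac_def split: if_splits\<close>)
    then have "curv_form A1 B1 Q [X, Y, Y, \<Phi> (dirac (sx i)), Y] \<noteq> 0"
      using F1[of "dirac 0" "dirac i" "dirac i" "dirac (sx i)" "dirac i"] A1[OF i] pts_simps i
      unfolding X_def Y_def sum_block[OF i] by simp
    then have "\<exists>n\<in>{1..k}. Y n \<noteq> 0"
      unfolding curv_form_Cons by (rule contrapos_np) (auto intro!: sum.neutral)
    then show ?thesis using that by blast
  qed
  \<comment> \<open>Combining images of vectors at \<open>P\<close> with preimages of vectors at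
    \<open>Q\<close> leaves a single surviving block on each side of the identities below.\<close>
  obtain w where w: "w \<in> pts N" "\<Phi> w = dirac (sx n)"
    using surj[OF pts_simps(3)[OF n]] by blast
  obtain Z where Z: "Z \<in> pts N" "\<Phi> Z = dirac n"
    using surj[OF pts_simps(2)[OF n]] by blast
  \<comment> \<open>Pairing with the v_j direction reads off the u_j component, and
    \<open>dirac (sx n)\<close> is orthogonal at \<open>Q\<close> to the images of the
    v-directions.\<close>
  have w_u: "w j = 0" if j: "j \<le> k" for j
  proof -
    have "gform P w (dirac (vx j)) = (\<Sum>l\<le>k. w l * dirac j l)"
      unfolding gform_def
      by (subst sum.neutral, use j in \<open>auto simp: dirac_simps intro!: sum.cong\<close>)
         (auto simp: dirac_def coord_defs)
    also have "\<dots> = w j" using j by (simp add: sum_dirac_u0)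
    finally have "w j = gform Q (dirac (sx n)) (\<Phi> (dirac (vx j)))"
      using iso[of w "dirac (vx j)"] w pts_simps j by simp
    also have "\<dots> = 0"
      unfolding gform_def using v_null[OF j] v_null'[OF j] n
      by (auto simp: dirac_simps)
    finally show ?thesis .
  qed
  define \<omega> where "\<omega> = w (sx i)"
  define C where "C = Z i"
  define \<xi> where "\<xi> = X (sx n)"

  have P1: "curv_form A B P (dirac 0 # dirac l # c # w # ts)
      = c l * w (sx l) * (A l (P l) * (\<Prod>t\<leftarrow>ts. t l))" if l: "l \<in> {1..k}" for A B c l ts
  proof -
    have "curv_form A B P (dirac 0 # dirac l # c # w # ts)
      = (\<Sum>m=1..k. (c m * w (sx m) * (A m (P m) * (\<Prod>t\<leftarrow>ts. t m))) * dirac l m)"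
      by (subst curv_form_sum1) (auto simp: dirac_simps w_u mult_ac intro!: sum.cong)
    then show ?thesis unfolding sum_block[OF l] .
  qed
  have Q1: "curv_form A B Q (X # b # c # dirac (sx n) # ts)
      = \<mu> * b n * c n * (A n (Q n) * (\<Prod>t\<leftarrow>ts. t n))" for A B b c ts
  proof -
    have "curv_form A B Q (X # b # c # dirac (sx n) # ts)
      = (\<Sum>m=1..k. (\<mu> * b m * c m * (A m (Q m) * (\<Prod>t\<leftarrow>ts. t m))) * dirac n m)"
      by (subst curv_form_sum1) (use n in \<open>auto simp: dirac_simps X_u \<mu>_def mult_ac intro!: sum.cong\<close>)
    then show ?thesis unfolding sum_block[OF n] .
  qed
  have P2: "curv_form A B P (dirac 0 # dirac i # c # dirac 0 # ts)
      = B i (P i) * c i * (\<Prod>t\<leftarrow>ts. t i)" for A B c ts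
  proof -
    have "curv_form A B P (dirac 0 # dirac i # c # dirac 0 # ts)
      = (\<Sum>m=1..k. (B m (P m) * c m * (\<Prod>t\<leftarrow>ts. t m)) * dirac i m)"
      by (subst curv_form_sum2) (auto simp: dirac_simps mult_ac intro!: sum.cong)
    then show ?thesis unfolding sum_block[OF i] .
  qed
  have Q2: "curv_form A B Q (X # b # dirac n # X # ts)
      = (2 * A n (Q n) * \<mu> * \<xi> + B n (Q n) * \<mu>\<^sup>2) * b n * (\<Prod>t\<leftarrow>ts. t n)" for A B b ts
  proof -
    have "curv_form A B Q (X # b # dirac n # X # ts)
      = (\<Sum>m=1..k. ((2 * A m (Q m) * \<mu> * X (sx m) + B m (Q m) * \<mu>\<^sup>2) * b m * (\<Prod>t\<leftarrow>ts. t m)) * dirac n m)"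
      by (subst curv_form_sum2) (auto simp: X_u \<mu>_def mult_ac intro!: sum.cong)
    then show ?thesis unfolding sum_block[OF n] \<xi>_def .
  qed

  \<comment> \<open>E1 to E3 use one test with 0, 1 and 2 differentiation slots, each giving a
    further factor \<open>Y n\<close>. E4 has \<open>Z\<close> in the third slot instead. E5 and E6
    use the second pattern.\<close>
  have E1: "\<omega> * A0 i (P i) = \<mu> * (Y n)\<^sup>2 * A0 n (Q n)"
    using F0[of "dirac 0" "dirac i" "dirac i" w] w pts_simps i
    by (simp add: P1 Q1 X_def[symmetric] Y_def[symmetric] \<omega>_def dirac_def power2_eq_square mult_ac)
  have E2: "\<omega> * A1 i (P i) = \<mu> * (Y n)^3 * A1 n (Q n)"
    using F1[of "dirac 0" "dirac i" "dirac i" w "dirac i"] w pts_simps i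
    by (simp add: P1 Q1 X_def[symmetric] Y_def[symmetric] \<omega>_def dirac_def power3_eq_cube mult_ac)
  have E3: "\<omega> * A2 i (P i) = \<mu> * (Y n)^4 * A2 n (Q n)"
    using F2[of "dirac 0" "dirac i" "dirac i" w "dirac i" "dirac i"] w pts_simps i
    by (simp add: P1 Q1 X_def[symmetric] Y_def[symmetric] \<omega>_def dirac_def power4_eq_xxxx mult_ac)
  have E4: "C * \<omega> * A0 i (P i) = \<mu> * Y n * A0 n (Q n)"
    using F0[of "dirac 0" "dirac i" Z w] w Z pts_simps i
    by (simp add: P1 Q1 X_def[symmetric] Y_def[symmetric] \<omega>_def C_def dirac_def[of n n] mult_ac)
  have E5: "B0 i (P i) * C = (2 * A0 n (Q n) * \<mu> * \<xi> + B0 n (Q n) * \<mu>\<^sup>2) * Y n"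
    using F0[of "dirac 0" "dirac i" Z "dirac 0"] w Z pts_simps i
    by (simp add: P2 Q2 X_def[symmetric] Y_def[symmetric] C_def mult_ac)
  have E6: "B1 i (P i) * C = (2 * A1 n (Q n) * \<mu> * \<xi> + B1 n (Q n) * \<mu>\<^sup>2) * (Y n)\<^sup>2"
    using F1[of "dirac 0" "dirac i" Z "dirac 0" "dirac i"] w Z pts_simps i
    by (simp add: P2 Q2 X_def[symmetric] Y_def[symmetric] C_def dirac_def[of i i] power2_eq_square mult_ac)
  \<comment> \<open>A mixed test with \<open>l\<close> and \<open>i\<close> shows that the image of
    the u_l direction has no u_n component; the test with \<open>l\<close> twice then gives the
    claim.\<close>
  have w_s: "w (sx l) = 0" if l: "l \<in> {1..k}" "l \<noteq> i" for l
  proof -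
    have "\<Phi> (dirac l) n = 0"
      using F0[of "dirac 0" "dirac l" "dirac i" w] w pts_simps i l \<mu> Y_n A0[OF n]
      by (simp add: P1 Q1 X_def[symmetric] Y_def[symmetric] dirac_def[of i l])
    then show ?thesis
      using F0[of "dirac 0" "dirac l" "dirac l" w] w pts_simps l A0[OF l(1)]
      by (simp add: P1 Q1 X_def[symmetric] dirac_def[of l l])
  qed
  \<comment> \<open>Comparing norms gives \<open>eps i * \<omega>\<^sup>2 = eps n\<close>. Both are
    signs and the square is nonnegative, so the signs agree.\<close>
  have \<omega>_sq: "\<omega>\<^sup>2 = 1"
  proof -
    have "gform P w w = (\<Sum>l=1..k. eps l * (w (sx l))\<^sup>2 * dirac i l)"
      unfolding gform_def
      by (auto simp: w_u w_s dirac_def power2_eq_square intro!: sum.cong)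
    then have "gform P w w = eps i * \<omega>\<^sup>2" unfolding sum_block[OF i] \<omega>_def .
    moreover have "gform Q (dirac (sx n)) (dirac (sx n)) = eps n"
      using gF_s[OF n, of Q "sx n"] unfolding gF_eq_gform by (simp add: dirac_def)
    ultimately have "eps i * \<omega>\<^sup>2 = eps n"
      using iso[of w w] w by simp
    moreover have "\<omega>\<^sup>2 \<ge> 0" by simp
    ultimately show ?thesis
      using eps[OF i] eps[OF n] by (elim disjE) auto
  qed

  show ?thesis
    using block_invariants_algebra[OF A0[OF i] A1[OF i] A0[OF n] A1[OF n] \<mu> Y_n \<omega>_sq E1 E2 E3 E4 E5 E6] n
    by blast
qed

end

section \<open>Functions of one variable with finitely many invariant values\<close>

lemma has_field_derivative_zero_const:
  fixes h :: "real \<Rightarrow> real"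
  assumes "\<And>u. (h has_real_derivative 0) (at u)"
  shows "h u = h 0"
  using DERIV_isconst_all[of h] assms by blast

text \<open>Here \<open>a\<close> stands for f' + 1, so that \<open>2 * a u - 1\<close> is the
  factor 2 f' + 1 of \<open>rho1\<close>.\<close>

lemma block_invariants_not_finite:
  fixes f a b c :: "real \<Rightarrow> real" and e :: real
  assumes f: "\<And>u. (f has_real_derivative a u - 1) (at u)"
    and a: "\<And>u. (a has_real_derivative b u) (at u)"
    and b: "\<And>u. (b has_real_derivative c u) (at u)"
    and c: "continuous_on UNIV c"
    and e: "\<bar>e\<bar> = 1"
    and a0: "\<And>u. a u \<noteq> 0" and b0: "\<And>u. b u \<noteq> 0"
    and fin1: "finite (range (\<lambda>u. a u * c u / (b u)\<^sup>2))"
    and fin2: "finite (range (\<lambda>u. (2 * e * f u * (2 * a u - 1) * a u - e * (f u)\<^sup>2 * b u) * b u / a u ^ 4))"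
  shows False
proof -
  have "continuous_on UNIV a" "continuous_on UNIV b"
    using a b by (meson DERIV_isCont continuous_at_imp_continuous_on)+
  then have "continuous_on UNIV (\<lambda>u. a u * c u / (b u)\<^sup>2)"
    using c b0 by (intro continuous_intros) auto
  then have "(\<lambda>u. a u * c u / (b u)\<^sup>2) constant_on UNIV"
    using fin1 by (intro continuous_finite_range_constant) auto
  then obtain \<gamma> where \<gamma>: "a u * c u / (b u)\<^sup>2 = \<gamma>" for u
    unfolding constant_on_def by blast
  \<comment> \<open>The derivative of a/b is 1 - ac/b^2, so subtracting this slope leaves a
    constant.\<close>
  define l where "l u = a u / b u - (1 - \<gamma>) * u" for u
  have "(l has_real_derivative 0) (at u)" for u
    unfolding l_def
    by (rule a b derivative_eq_intros refl b0)+
       (use b0[of u] in \<open>simp add: \<gamma>[of u, symmetric] field_simps power2_eq_square\<close>)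
  then have lin: "a u / b u - (1 - \<gamma>) * u = l 0" for u
    using has_field_derivative_zero_const[of l u] unfolding l_def by simp
  have "\<gamma> = 1"
  proof (rule ccontr)
    assume "\<gamma> \<noteq> 1"
    \<comment> \<open>The zero of a nonconstant affine function.\<close>
    then have "a (- l 0 / (1 - \<gamma>)) / b (- l 0 / (1 - \<gamma>)) = 0"
      using lin[of "- l 0 / (1 - \<gamma>)"] by simp
    then show False using a0 b0 by simp
  qed
  define \<beta> where "\<beta> = inverse (l 0)"
  have l0: "l 0 \<noteq> 0" using lin[of 0] a0 b0 by auto
  then have \<beta>: "\<beta> \<noteq> 0" by (simp add: \<beta>_def)
  have b_eq: "b u = \<beta> * a u" for u
    using lin[of u] b0[of u] l0 unfolding \<open>\<gamma> = 1\<close> \<beta>_def by (simp add: field_simps)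
  define A where "A = a 0"
  have "((\<lambda>u. a u * exp (- \<beta> * u)) has_real_derivative 0) (at u)" for u
    by (rule a derivative_eq_intros refl)+ (simp add: b_eq)
  from has_field_derivative_zero_const[OF this] have "a u * exp (- \<beta> * u) = A" for u
    by (simp add: A_def)
  then have a_eq: "a u = A * exp (\<beta> * u)" for u
    by (simp add: exp_minus field_simps)
  \<comment> \<open>Since b = \<open>\<beta>\<close> a, the function a/\<open>\<beta>\<close> is a
    primitive of a, and f' = a - 1 integrates to f = a/\<open>\<beta>\<close> - u + C.\<close>
  define C where "C = f 0 - a 0 / \<beta>"
  have "((\<lambda>u. f u - a u / \<beta> + u) has_real_derivative 0) (at u)" for u
    by (rule f a DERIV_ident derivative_eq_intros refl \<beta>)+ (simp_all add: b_eq \<beta>)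
  from has_field_derivative_zero_const[OF this] have f_eq: "f u - a u / \<beta> + u = C" for u
    by (simp add: C_def)

  define I where "I u = (2 * e * f u * (2 * a u - 1) * a u - e * (f u)\<^sup>2 * b u) * b u / a u ^ 4" for u
  obtain M where M: "\<bar>I u\<bar> \<le> M" for u
    using finite_imp_bounded[OF fin2] unfolding I_def[symmetric] bounded_iff by auto
  \<comment> \<open>At \<open>u\<close> the exponent \<open>\<beta> * u\<close> is
    \<open>- \<tau>\<close>. The summand \<open>4 * \<bar>A\<bar>\<close> forces
    \<open>\<bar>a u\<bar> \<le> 1/4\<close>, the next one absorbs \<open>\<beta> * C\<close>, and
    \<open>M + 2\<close> leaves \<open>y \<ge> M + 1\<close>.\<close>
  define \<tau> where "\<tau> = 4 * \<bar>A\<bar> + \<bar>\<beta> * C\<bar> + M + 2"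
  define u where "u = - \<tau> / \<beta>"
  define y where "y = \<beta> * f u"
  have "M \<ge> 0" using M[of 0] by linarith
  then have "\<tau> \<ge> 4 * \<bar>A\<bar>" by (simp add: \<tau>_def)
  have "\<bar>a u\<bar> = \<bar>A\<bar> * exp (- \<tau>)"
    using \<beta> by (simp add: a_eq u_def abs_mult)
  also have "\<dots> \<le> 1 / 4"
  proof -
    have "4 * \<bar>A\<bar> \<le> exp \<tau>"
      using exp_ge_add_one_self[of \<tau>] \<open>\<tau> \<ge> 4 * \<bar>A\<bar>\<close> by linarith
    then show ?thesis by (simp add: exp_minus field_simps)
  qed
  finally have a_small: "\<bar>a u\<bar> \<le> 1 / 4" .
  have "y = a u + \<beta> * C + \<tau>"
  proof -
    have "\<beta> * f u = \<beta> * (a u / \<beta>) + \<beta> * C - \<beta> * u"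
      unfolding f_eq[of u, symmetric] by (simp add: algebra_simps)
    then show ?thesis using \<beta> by (simp add: y_def u_def)
  qed
  then have y: "y \<ge> M + 1"
    using a_small unfolding \<tau>_def by linarith
  \<comment> \<open>For large \<open>y\<close> and small \<open>a u\<close> the term in y^2
    dominates, so the absolute value is at least \<open>y\<close>, which exceeds
    \<open>M\<close>.\<close>
  have "I u = e * (y * (4 * a u - 2 - y) / (a u)\<^sup>2)"
    using a0[of u] unfolding I_def b_eq y_def by (simp add: field_simps power2_eq_square power4_eq_xxxx)
  then have "\<bar>I u\<bar> = \<bar>y\<bar> * \<bar>4 * a u - 2 - y\<bar> / (a u)\<^sup>2"
    using e by (simp add: abs_mult)
  moreover have "\<bar>y\<bar> = y" "\<bar>4 * a u - 2 - y\<bar> = 2 + y - 4 * a u"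
    using y \<open>M \<ge> 0\<close> a_small by linarith+
  ultimately have "\<bar>I u\<bar> = y * (2 + y - 4 * a u) / (a u)\<^sup>2"
    by simp
  moreover have "y * 1 \<le> y * (2 + y - 4 * a u)"
    using y \<open>M \<ge> 0\<close> a_small by (intro mult_left_mono) linarith+
  moreover have "y * (2 + y - 4 * a u) * 1 \<le> y * (2 + y - 4 * a u) / (a u)\<^sup>2"
  proof -
    have "(a u)\<^sup>2 \<le> 1" using a_small by (simp add: abs_square_le_1)
    then show ?thesis
      using a0[of u] y \<open>M \<ge> 0\<close> \<open>y * 1 \<le> y * (2 + y - 4 * a u)\<close>
      by (simp add: le_divide_eq mult_left_le)
  qed
  ultimately show False using M[of u] y by linarith
qed

theorem theorem1p9:
  fixes k :: nat and f :: "nat \<Rightarrow> real \<Rightarrow> real" and eps :: "nat \<Rightarrow> real"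
  assumes "k \<ge> 1"
    and "\<forall>i\<in>{1..k}. eps i = 1 \<or> eps i = -1"
    and "\<forall>i\<in>{1..k}. smooth_fun (f i)"
    and "\<forall>i\<in>{1..k}. \<forall>u. deriv (f i) u + 1 \<noteq> 0"
    and "\<forall>i\<in>{1..k}. \<forall>u. deriv (deriv (f i)) u \<noteq> 0"
  shows "\<not> curv_homog (3*k+2) (gF k f eps) 2"
proof
  assume hom: "curv_homog (3*k+2) (gF k f eps) 2"
  interpret F_metric k f eps
    using assms(2,3) by unfold_locales auto
  have one: "1 \<in> {1..k}" using assms(1) by simp
  define \<alpha> where "\<alpha> n u = (deriv (f n) u + 1) * deriv (deriv (deriv (f n))) u / (deriv (deriv (f n)) u)\<^sup>2" for n u
  define I where "I n u = (rho1 n u * (deriv (f n) u + 1) - rho n u * deriv (deriv (f n)) u)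
      * deriv (deriv (f n)) u / (deriv (f n) u + 1) ^ 4" for n u
  have inv: "\<exists>n\<in>{1..k}. \<alpha> 1 u = \<alpha> n 0 \<and> I 1 u = I n 0" for u
  proof -
    \<comment> \<open>Only u_1 varies in \<open>P\<close>, while \<open>Q\<close> is the origin: the
      right-hand values are indexed by the finitely many blocks, whatever \<open>u\<close>
      is.\<close>
    define P :: "nat \<Rightarrow> real" where "P j = (if j = 1 then u else 0)" for j
    define Q :: "nat \<Rightarrow> real" where "Q j = 0" for j
    have "P \<in> pts N" "Q \<in> pts N"
      using assms(1) by (auto simp: pts_def P_def Q_def N_def)
    then obtain A where bij: "bij_betw (matapp N A) (pts N) (pts N)"
      and iso: "\<And>v w. v \<in> pts N \<Longrightarrow> w \<in> pts N \<Longrightarrow>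
        gval N g Q (matapp N A v) (matapp N A w) = gval N g P v w"
      and R: "\<And>i vs. i \<le> 2 \<Longrightarrow> length vs = 4 + i \<Longrightarrow> set vs \<subseteq> pts N \<Longrightarrow>
        teval N (nablaR N g i) Q (map (matapp N A) vs) = teval N (nablaR N g i) P vs"
      using hom unfolding curv_homog_def N_def[symmetric] by metis
    have "\<exists>n\<in>{1..k}. \<alpha> 1 (P 1) = \<alpha> n (Q n) \<and> I 1 (P 1) = I n (Q n)"
      unfolding \<alpha>_def I_def
    proof (rule block_invariants[OF _ _ bij])
      fix a b c d t t' :: "nat \<Rightarrow> real"
      let ?\<Phi> = "matapp N A"
      show "{a, b, c, d} \<subseteq> pts N \<Longrightarrow> curv_form (\<lambda>n u. deriv (f n) u + 1) rho Q [?\<Phi> a, ?\<Phi> b, ?\<Phi> c, ?\<Phi> d]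
          = curv_form (\<lambda>n u. deriv (f n) u + 1) rho P [a, b, c, d]"
        using R[of 0 "[a, b, c, d]"] by (simp add: teval_nablaR del: nablaR.simps)
      show "{a, b, c, d, t} \<subseteq> pts N \<Longrightarrow>
          curv_form (\<lambda>n. deriv (deriv (f n))) rho1 Q [?\<Phi> a, ?\<Phi> b, ?\<Phi> c, ?\<Phi> d, ?\<Phi> t]
          = curv_form (\<lambda>n. deriv (deriv (f n))) rho1 P [a, b, c, d, t]"
        using R[of 1 "[a, b, c, d, t]"] by (simp add: teval_nablaR[unfolded One_nat_def] del: nablaR.simps)
      show "{a, b, c, d, t, t'} \<subseteq> pts N \<Longrightarrow>
          curv_form (\<lambda>n. deriv (deriv (deriv (f n)))) rho2 Q [?\<Phi> a, ?\<Phi> b, ?\<Phi> c, ?\<Phi> d, ?\<Phi> t, ?\<Phi> t']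
          = curv_form (\<lambda>n. deriv (deriv (deriv (f n)))) rho2 P [a, b, c, d, t, t']"
        using R[of 2 "[a, b, c, d, t, t']"] by (simp add: teval_nablaR del: nablaR.simps)
    qed (use assms iso one in \<open>auto simp: gval_eq\<close>)
    then show ?thesis by (simp add: P_def Q_def)
  qed
  have "range (\<alpha> 1) \<subseteq> (\<lambda>n. \<alpha> n 0) ` {1..k}" "range (I 1) \<subseteq> (\<lambda>n. I n 0) ` {1..k}"
    using inv by blast+
  then have fin: "finite (range (\<alpha> 1))" "finite (range (I 1))"
    by (meson finite_subset finite_imageI finite_atLeastAtMost)+
  show False
  proof (rule block_invariants_not_finite[where f = "f 1" and a = "\<lambda>u. deriv (f 1) u + 1"
        and b = "deriv (deriv (f 1))" and c = "deriv (deriv (deriv (f 1)))" and e = "eps 1"])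
    fix u
    show "(f 1 has_real_derivative deriv (f 1) u + 1 - 1) (at u)"
      using DERIV_f(1)[OF one] by simp
    show "((\<lambda>u. deriv (f 1) u + 1) has_real_derivative deriv (deriv (f 1)) u) (at u)"
      using DERIV_add[OF DERIV_f(2)[OF one] DERIV_const] by simp
    show "(deriv (deriv (f 1)) has_real_derivative deriv (deriv (deriv (f 1))) u) (at u)"
      by (rule DERIV_f(3)[OF one])
  next
    have "(deriv (deriv (deriv (f 1))) has_real_derivative (deriv ^^ 4) (f 1) u) (at u)" for u
      using DERIV_iter_deriv[OF one, of 3 u] by (simp add: numeral_eq_Suc)
    then show "continuous_on UNIV (deriv (deriv (deriv (f 1))))"
      by (meson DERIV_isCont continuous_at_imp_continuous_on)
  next
    have "I 1 = (\<lambda>u. (2 * eps 1 * f 1 u * (2 * (deriv (f 1) u + 1) - 1) * (deriv (f 1) u + 1)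
        - eps 1 * (f 1 u)\<^sup>2 * deriv (deriv (f 1)) u) * deriv (deriv (f 1)) u / (deriv (f 1) u + 1) ^ 4)"
      by (simp add: I_def fun_eq_iff rho1_def rho_def algebra_simps)
    then show "finite (range (\<lambda>u. (2 * eps 1 * f 1 u * (2 * (deriv (f 1) u + 1) - 1) * (deriv (f 1) u + 1)
        - eps 1 * (f 1 u)\<^sup>2 * deriv (deriv (f 1)) u) * deriv (deriv (f 1)) u / (deriv (f 1) u + 1) ^ 4))"
      using fin(2) by simp
  next
    show "\<bar>eps 1\<bar> = 1" using eps[OF one] by auto
  qed (use fin(1) assms one in \<open>auto simp: \<alpha>_def[abs_def]\<close>)
qed

end
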